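(* Let $d\ge 1$. There exists a positive function $\psi(t)$ on $t\ge 0$ with fast decay at infinity, that is, for every $\alpha$ there is a constant $c(\alpha)$ with $\psi(t)\le c(\alpha)(1+t)^{-\alpha}$ for all $t\ge 0$, such that for every measurable set $\Omega$ in the Euclidean space $\mathbb{R}^d$ and every $R>0$ there exist entire functions $A(x)$ and $B(x)$ of exponential type $R$ satisfying, for all $x\in\mathbb{R}^d$, $$A(x)\le \chi_\Omega(x)\le B(x),\qquad |B(x)-A(x)|\le \psi\left(R\operatorname{dist}(x,\partial\Omega)\right).$$ (The function $\psi$ does not depend on $\Omega$ or $R$.)
   Context: $\chi_\Omega$ is the characteristic function of $\Omega$, $\partial\Omega$ its topological boundary, and $\operatorname{dist}$ the Euclidean distance; if $\partial\Omega=\emptyset$ the distance is $+\infty$ and $\psi(+\infty)$ is read as $0$. An entire function of exponential type $R$ is an entire function $F$ on $\mathbb{C}^d$ such that, for some constant $C$, $|F(x+iy)|\le C\exp(2\pi R|y|)$ for all $x,y\in\mathbb{R}^d$ (the normalization corresponding to the Fourier transform $\widehat f(\xi)=\int f(x)e^{-2\pi i\xi\cdot x}dx$ being supported in $|\xi|\le R$). $A$ and $B$ are real valued on $\mathbb{R}^d$. *)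

theory Defs
  imports "HOL-Analysis.Analysis"
begin

definition cvec :: "real ^ 'n \<Rightarrow> real ^ 'n \<Rightarrow> complex ^ 'n" where
  "cvec x y = (\<chi> j. complex_of_real (x $ j) + \<i> * complex_of_real (y $ j))"

text \<open>The derivative relation is the Frechet one over the reals; requiring the derivative to be
  complex linear makes it complex differentiability in several variables.\<close>

definition entire_cvec :: "(complex ^ 'n \<Rightarrow> complex) \<Rightarrow> bool" where
  "entire_cvec F \<longleftrightarrow>
     (\<forall>z. \<exists>D. (F has_derivative D) (at z) \<and> (\<forall>c v. D (c *s v) = c * D v))"

text \<open>The factor \<open>2 * pi\<close> matches the Fourier transform with kernel
  \<open>exp (- 2 * pi * \<i> * (\<xi> \<bullet> x))\<close>.\<close>

definition entire_exp_type :: "real \<Rightarrow> (complex ^ 'n \<Rightarrow> complex) \<Rightarrow> bool" where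
  "entire_exp_type R F \<longleftrightarrow> entire_cvec F \<and>
     (\<exists>C. \<forall>x y. norm (F (cvec x y)) \<le> C * exp (2 * pi * R * norm y))"

definition fast_decay :: "(real \<Rightarrow> real) \<Rightarrow> bool" where
  "fast_decay \<psi> \<longleftrightarrow> (\<forall>\<alpha>::real. \<exists>c. \<forall>t\<ge>0. \<psi> t \<le> c * (1 + t) powr (- \<alpha>))"

text \<open>The value of \<open>\<psi> (R * dist x S)\<close>. The library sets \<open>infdist x {} = 0\<close>, whereas here the
  distance to the empty set is infinite and \<open>\<psi>\<close> vanishes at infinity.\<close>

definition decay_dist :: "(real \<Rightarrow> real) \<Rightarrow> real \<Rightarrow> real ^ 'n \<Rightarrow> (real ^ 'n) set \<Rightarrow> real" where
  "decay_dist \<psi> R x S = (if S = {} then 0 else \<psi> (R * infdist x S))"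

end

theory Submission
  imports Defs "HOL-Complex_Analysis.Complex_Analysis" "HOL-Real_Asymp.Real_Asymp"
begin

unbundle no fps_syntax

text \<open>Let \<open>f(z) = \<Prod>\<^sub>n sinc (z / 2\<^sup>n)\<close> with \<open>n \<ge> 1\<close>: it has exponential type and, because of
  \<open>f(z) = sinc (z/2) f(z/2)\<close>, decays faster than every power along horizontal lines. If \<open>P\<close> is a
  primitive of \<open>f\<^sup>2\<close>, then \<open>k(z) = P(z + 1/2) - P(z - 1/2)\<close> has the same properties, is nonnegative on
  the real line, and its integer translates telescope to a constant. The tensor power \<open>K\<close> of the
  normalized \<open>k\<close> thus yields a nonnegative partition of unity \<open>K(R x - \<nu>)\<close>, indexed by the integer
  lattice, and every series \<open>\<Sum>\<^sub>\<nu> a(\<nu>) K(R z - \<nu>)\<close> with bounded coefficients is entire of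
  exponential type. Choosing \<open>a\<close> to be the values of the indicator function at \<open>\<nu> / R\<close> approximates the
  indicator up to \<open>\<phi>(R dist(x, \<partial>\<Omega>))\<close>, where \<open>\<phi>(t)\<close> is the largest mass that \<open>K(x - \<nu>)\<close> puts on
  \<open>|x - \<nu>| \<ge> t\<close>. This error is in turn dominated by the series with coefficients
  \<open>\<Phi>(\<nu>) = 2 \<phi>(R dist(\<nu>/R, \<partial>\<Omega>) - \<rho>)\<close>, provided \<open>\<phi>(\<rho>) \<le> 1/2\<close>. Subtracting and adding that series
  gives \<open>A\<close> and \<open>B\<close>.\<close>

section \<open>An infinite product of sinc functions\<close>

definition csinc :: "complex \<Rightarrow> complex" where
  "csinc z = (if z = 0 then 1 else sin z / z)"

text \<open>The singularity at 0 is removable: the function is the difference quotient of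
  \<open>sin\<close> at 0, completed by the derivative there.\<close>

lemma csinc_holomorphic: "csinc holomorphic_on UNIV"
proof -
  have "deriv sin (0::complex) = 1"
    by (rule DERIV_imp_deriv) (auto intro!: derivative_eq_intros)
  then have "csinc = (\<lambda>z. if z = 0 then deriv sin 0 else (sin z - sin 0) / (z - 0))"
    by (auto simp: csinc_def fun_eq_iff)
  with pole_lemma[of sin UNIV 0] show ?thesis
    by (simp add: holomorphic_on_sin holomorphic_on_ident)
qed

lemma norm_exp_i_le: "norm (exp (\<i> * z)) \<le> exp \<bar>Im z\<bar>" "norm (exp (- (\<i> * z))) \<le> exp \<bar>Im z\<bar>"
  by (auto simp: norm_exp_eq_Re)

lemma norm_sin_le_exp_Im: "norm (sin z) \<le> exp \<bar>Im z\<bar>" for z :: complex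
proof -
  have "norm (exp (\<i> * z) - exp (- (\<i> * z))) \<le> 2 * exp \<bar>Im z\<bar>"
    using norm_triangle_ineq4[of "exp (\<i> * z)" "exp (- (\<i> * z))"] norm_exp_i_le[of z] by linarith
  then show ?thesis
    by (simp add: sin_exp_eq norm_divide norm_mult)
qed

lemma norm_cos_le_exp_Im: "norm (cos z) \<le> exp \<bar>Im z\<bar>" for z :: complex
proof -
  have "norm (exp (\<i> * z) + exp (- (\<i> * z))) \<le> 2 * exp \<bar>Im z\<bar>"
    using norm_triangle_ineq[of "exp (\<i> * z)" "exp (- (\<i> * z))"] norm_exp_i_le[of z] by linarith
  then show ?thesis
    by (simp add: cos_exp_eq norm_divide norm_mult)
qed

text \<open>Mean value inequality for \<open>sin\<close> between 0 and \<open>z\<close> on a convex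
  horizontal strip, where the derivative \<open>cos\<close> is at most
  \<open>exp \<bar>Im z\<bar>\<close>. The constant 1 in front matters, because these bounds get
  multiplied over infinitely many factors.\<close>

lemma norm_csinc_le: "norm (csinc z) \<le> exp \<bar>Im z\<bar>"
proof (cases "z = 0")
  case False
  have "norm (sin z - sin 0) \<le> exp \<bar>Im z\<bar> * norm (z - 0)"
  proof (rule field_differentiable_bound)
    show "convex {w. \<bar>Im w\<bar> \<le> \<bar>Im z\<bar>}"
    proof -
      have "{w. \<bar>Im w\<bar> \<le> \<bar>Im z\<bar>} = Im -` {- \<bar>Im z\<bar>..\<bar>Im z\<bar>}" by auto
      then show ?thesis
        by (metis convex_linear_vimage bounded_linear_Im bounded_linear.linear convex_real_interval(5))
    qed
    show "norm (cos w) \<le> exp \<bar>Im z\<bar>" if "w \<in> {w. \<bar>Im w\<bar> \<le> \<bar>Im z\<bar>}" for w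
      by (rule order_trans[OF norm_cos_le_exp_Im]) (use that in auto)
  qed (auto intro!: derivative_eq_intros)
  with False show ?thesis
    by (simp add: csinc_def norm_divide divide_le_eq)
qed (simp add: csinc_def)

text \<open>Each sinc factor contributes one power of decay; an infinite product of them can
  therefore beat every power.\<close>

lemma csinc_decay: "norm (csinc z) * (1 + norm z) \<le> 2 * exp \<bar>Im z\<bar>"
proof -
  have "norm (csinc z) * norm z \<le> exp \<bar>Im z\<bar>"
    using norm_sin_le_exp_Im[of z] by (auto simp: csinc_def norm_divide)
  with norm_csinc_le[of z] show ?thesis
    by (simp add: algebra_simps)
qed

text \<open>Two mean value inequalities on a disc: first for \<open>cos w - 1\<close>, then for
  \<open>sin w - w\<close>, whose derivative it is. The linear smallness at 0 makes the product over
  \<open>z / 2 ^ Suc n\<close> converge.\<close>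

lemma norm_csinc_minus_1_le: "norm (csinc z - 1) \<le> norm z * exp (norm z)"
proof (cases "z = 0")
  case False
  let ?r = "norm z"
  have cos: "norm (cos w - 1) \<le> ?r * exp ?r" if "norm w \<le> ?r" for w :: complex
  proof -
    have "norm (cos w - cos 0) \<le> exp ?r * norm (w - 0)"
    proof (rule field_differentiable_bound[of "cball 0 ?r" cos "\<lambda>w. - sin w"])
      show "norm (- sin v) \<le> exp ?r" if "v \<in> cball 0 ?r" for v :: complex
      proof -
        have "\<bar>Im v\<bar> \<le> ?r" using abs_Im_le_cmod[of v] that by simp
        with order_trans[OF norm_sin_le_exp_Im[of v], of "exp ?r"] show ?thesis by simp
      qed
    qed (use that in \<open>auto intro!: derivative_eq_intros\<close>)
    also have "\<dots> \<le> exp ?r * ?r" using that by simp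
    finally show ?thesis by (simp add: mult.commute)
  qed
  have "norm ((sin z - z) - (sin 0 - 0)) \<le> (?r * exp ?r) * norm (z - 0)"
    by (rule field_differentiable_bound[of "cball 0 ?r" _ "\<lambda>w. cos w - 1"])
       (auto intro!: derivative_eq_intros cos)
  then have "norm ((sin z - z) / z) \<le> ?r * exp ?r"
    using False by (simp add: norm_divide divide_le_eq)
  with False show ?thesis
    by (simp add: csinc_def diff_divide_distrib)
qed (simp add: csinc_def)

lemma csinc_in_Reals: "z \<in> \<real> \<Longrightarrow> csinc z \<in> \<real>"
  by (auto simp: csinc_def elim!: Reals_cases simp flip: sin_of_real)

section \<open>The infinite product and its functional equation\<close>

definition sinc_prod :: "nat \<Rightarrow> complex \<Rightarrow> complex" where
  "sinc_prod N z = (\<Prod>n<N. csinc (z / 2 ^ Suc n))"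

text \<open>Up to normalization, the Fourier transform of Rvachev's compactly supported smooth up-function.\<close>

definition up_transform :: "complex \<Rightarrow> complex" where
  "up_transform z = lim (\<lambda>N. sinc_prod N z)"

lemma sinc_prod_Suc: "sinc_prod (Suc N) z = csinc (z / 2) * sinc_prod N (z / 2)"
  by (simp add: sinc_prod_def prod.lessThan_Suc_shift del: prod.lessThan_Suc)

text \<open>The bound is uniform in \<open>N\<close>: the first factor and the remaining product at
  \<open>z / 2\<close> each use half of the exponent, and the halves add up.\<close>

lemma norm_sinc_prod_le: "norm (sinc_prod N z) \<le> exp \<bar>Im z\<bar>"
proof (induction N arbitrary: z)
  case (Suc N)
  have "norm (sinc_prod (Suc N) z) \<le> exp \<bar>Im (z / 2)\<bar> * exp \<bar>Im (z / 2)\<bar>"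
    unfolding sinc_prod_Suc norm_mult by (intro mult_mono norm_csinc_le Suc.IH) auto
  then show ?case by (simp flip: exp_add)
qed (simp add: sinc_prod_def)

text \<open>On the disc of radius \<open>r\<close> the deviations of the factors from 1 are
  dominated by the geometric series \<open>r * exp r * (1/2) ^ n\<close>.\<close>

lemma uniformly_convergent_sinc_prod: "uniformly_convergent_on (cball 0 r) sinc_prod"
  unfolding sinc_prod_def
proof (rule uniformly_convergent_on_prod')
  show "continuous_on (cball 0 r) (\<lambda>z. csinc (z / 2 ^ Suc n))" for n
    by (intro holomorphic_on_imp_continuous_on holomorphic_on_compose_gen[OF _ csinc_holomorphic, unfolded o_def])
       (auto intro!: holomorphic_intros)
  show "uniformly_convergent_on (cball 0 r) (\<lambda>N z. \<Sum>n<N. norm (csinc (z / 2 ^ Suc n) - 1))"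
  proof (rule Weierstrass_m_test')
    show "summable (\<lambda>n. (r * exp r) * (1/2) ^ n)"
      by (intro summable_mult summable_geometric) auto
  next
    fix n and z :: complex assume "z \<in> cball 0 r"
    then have z: "norm z \<le> r" by simp
    with norm_ge_zero[of z] have r: "r \<ge> 0" by linarith
    have le: "norm (z / 2 ^ Suc n) \<le> r * (1/2) ^ n"
    proof -
      have "norm z / 2 ^ Suc n \<le> r / 2 ^ n"
        by (intro frac_le) (use z r in auto)
      then show ?thesis by (simp add: norm_divide norm_power power_one_over)
    qed
    moreover have "r * (1/2) ^ n \<le> r"
      using r by (intro mult_left_le) (auto simp: power_le_one)
    ultimately have "norm (z / 2 ^ Suc n) * exp (norm (z / 2 ^ Suc n)) \<le> (r * (1/2) ^ n) * exp r"
      using r by (intro mult_mono) auto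
    then show "norm (norm (csinc (z / 2 ^ Suc n) - 1)) \<le> (r * exp r) * (1/2) ^ n"
      using norm_csinc_minus_1_le[of "z / 2 ^ Suc n"] by (simp add: mult_ac)
  qed
qed auto

lemma uniform_limit_up_transform:
  "uniform_limit (cball 0 r) sinc_prod up_transform sequentially"
proof -
  obtain l where l: "uniform_limit (cball 0 r) sinc_prod l sequentially"
    using uniformly_convergent_sinc_prod[of r] unfolding uniformly_convergent_on_def by auto
  have "l z = up_transform z" if "z \<in> cball 0 r" for z
    using tendsto_uniform_limitI[OF l that] unfolding up_transform_def by (simp add: limI)
  with l show ?thesis
    by (subst (asm) uniform_limit_cong'[where g=sinc_prod]) auto
qed

lemma LIMSEQ_up_transform: "(\<lambda>N. sinc_prod N z) \<longlonglongrightarrow> up_transform z"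
  by (rule tendsto_uniform_limitI[OF uniform_limit_up_transform[of "norm z"]]) simp

lemma up_transform_holomorphic: "up_transform holomorphic_on UNIV"
proof (rule holomorphic_uniform_sequence)
  show "sinc_prod n holomorphic_on UNIV" for n
    unfolding sinc_prod_def
    by (intro holomorphic_intros holomorphic_on_compose_gen[OF _ csinc_holomorphic, unfolded o_def]) auto
  show "\<exists>d>0. cball x d \<subseteq> UNIV \<and> uniform_limit (cball x d) sinc_prod up_transform sequentially" for x
  proof (intro exI conjI)
    have "cball x 1 \<subseteq> cball 0 (norm x + 1)"
      by (simp add: cball_subset_cball_iff)
    then show "uniform_limit (cball x 1) sinc_prod up_transform sequentially"
      by (rule uniform_limit_on_subset[OF uniform_limit_up_transform])
  qed auto
qed auto

lemma up_transform_functional: "up_transform z = csinc (z / 2) * up_transform (z / 2)"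
proof (rule LIMSEQ_unique)
  show "(\<lambda>N. sinc_prod (Suc N) z) \<longlonglongrightarrow> up_transform z"
    by (rule LIMSEQ_Suc[OF LIMSEQ_up_transform])
  show "(\<lambda>N. sinc_prod (Suc N) z) \<longlonglongrightarrow> csinc (z / 2) * up_transform (z / 2)"
    unfolding sinc_prod_Suc by (intro tendsto_intros LIMSEQ_up_transform)
qed

lemma up_transform_0: "up_transform 0 = 1"
  using LIMSEQ_up_transform[of 0] by (simp add: sinc_prod_def csinc_def LIMSEQ_const_iff)

text \<open>Real values on the real axis make the square of this function nonnegative there, which
  is the source of all positivity below.\<close>

lemma up_transform_in_Reals: "z \<in> \<real> \<Longrightarrow> up_transform z \<in> \<real>"
  by (rule Lim_in_closed_set[OF closed_complex_Reals _ _ LIMSEQ_up_transform[of z]])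
     (auto simp: sinc_prod_def intro!: always_eventually prod_in_Reals csinc_in_Reals Reals_divide)

text \<open>Induction through the functional equation: the factor \<open>csinc (z / 2)\<close>
  supplies one new power, \<open>up_transform (z / 2)\<close> the previous \<open>N\<close>, and the
  two exponents \<open>\<bar>Im (z / 2)\<bar>\<close> recombine, so the type does not grow.\<close>

lemma up_transform_decay:
  "\<exists>C>0. \<forall>z. norm (up_transform z) * (1 + \<bar>Re z\<bar>) ^ N \<le> C * exp \<bar>Im z\<bar>"
proof (induction N)
  case 0
  have "norm (up_transform z) \<le> exp \<bar>Im z\<bar>" for z
    by (rule tendsto_upperbound[OF tendsto_norm[OF LIMSEQ_up_transform[of z]]])
       (auto intro!: always_eventually norm_sinc_prod_le)
  then show ?case by (intro exI[of _ 1]) auto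
next
  case (Suc N)
  then obtain C where C: "C > 0"
    "\<And>z. norm (up_transform z) * (1 + \<bar>Re z\<bar>) ^ N \<le> C * exp \<bar>Im z\<bar>" by blast
  \<comment> \<open>The factor \<open>2 ^ Suc N\<close> pays for replacing \<open>Re z\<close> by
    \<open>Re (z / 2)\<close>, the other 2 comes from \<open>csinc_decay\<close>.\<close>
  show ?case
  proof (intro exI[of _ "4 * 2 ^ N * C"] conjI allI)
    fix z :: complex
    let ?w = "z / 2"
    have 1: "norm (csinc ?w) * (1 + \<bar>Re ?w\<bar>) \<le> 2 * exp \<bar>Im ?w\<bar>"
      by (rule order_trans[OF mult_left_mono csinc_decay]) (use abs_Re_le_cmod[of ?w] in auto)
    have le: "1 + \<bar>Re z\<bar> \<le> 2 * (1 + \<bar>Re ?w\<bar>)" by simp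
    have "norm (up_transform z) * (1 + \<bar>Re z\<bar>) ^ Suc N
          \<le> norm (up_transform z) * (2 * (1 + \<bar>Re ?w\<bar>)) ^ Suc N"
      by (intro mult_left_mono power_mono le) auto
    also have "\<dots> = 2 * 2 ^ N * ((norm (csinc ?w) * (1 + \<bar>Re ?w\<bar>)) *
                      (norm (up_transform ?w) * (1 + \<bar>Re ?w\<bar>) ^ N))"
      by (subst up_transform_functional) (simp only: norm_mult power_mult_distrib power_Suc mult_ac)
    also have "\<dots> \<le> 2 * 2 ^ N * ((2 * exp \<bar>Im ?w\<bar>) * (C * exp \<bar>Im ?w\<bar>))"
      by (intro mult_left_mono mult_mono 1 C(2)) (auto intro!: mult_nonneg_nonneg)
    also have "\<dots> = 4 * 2 ^ N * C * exp (\<bar>Im ?w\<bar> + \<bar>Im ?w\<bar>)"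
      by (simp only: exp_add) simp
    also have "\<bar>Im ?w\<bar> + \<bar>Im ?w\<bar> = \<bar>Im z\<bar>" by simp
    finally show "norm (up_transform z) * (1 + \<bar>Re z\<bar>) ^ Suc N \<le> 4 * 2 ^ N * C * exp \<bar>Im z\<bar>" .
  qed (use C in auto)
qed

section \<open>Partitions of unity by integer translates\<close>

lemma summable_int_weight: "(\<lambda>m::int. 1 / (1 + \<bar>real_of_int m\<bar>)\<^sup>2) summable_on UNIV"
proof -
  have "summable (\<lambda>n. 1 / (1 + real n)\<^sup>2)"
    using inverse_power_summable[of 2, where 'a=real] summable_Suc_iff[of "\<lambda>n. inverse ((real n)\<^sup>2)"]
    by (simp add: inverse_eq_divide)
  then have nat: "(\<lambda>n. 1 / (1 + real n)\<^sup>2) summable_on UNIV"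
    by (rule summable_nonneg_imp_summable_on) auto
  have "(\<lambda>m::int. 1 / (1 + \<bar>real_of_int m\<bar>)\<^sup>2) summable_on range int"
    by (subst summable_on_reindex) (use nat in \<open>auto simp: o_def\<close>)
  moreover have "(\<lambda>m::int. 1 / (1 + \<bar>real_of_int m\<bar>)\<^sup>2) summable_on range (\<lambda>n. - int n)"
    by (subst summable_on_reindex) (use nat in \<open>auto simp: o_def inj_def\<close>)
  moreover have "range int \<union> range (\<lambda>n. - int n) = UNIV"
    by (auto simp: image_iff) (metis int_cases2)
  ultimately show ?thesis
    by (metis summable_on_union)
qed

text \<open>Uniformity in \<open>t\<close> comes from translating by
  \<open>\<lfloor>t\<rfloor>\<close>: moving the centre by less than 1 changes the weight by a
  factor of at most 4, and the translated sum does not depend on \<open>t\<close>.\<close>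

lemma lattice_weight_bounded:
  obtains Q :: real where "Q > 0"
    "\<And>t::real. (\<lambda>m::int. 1 / (1 + \<bar>t - of_int m\<bar>)\<^sup>2) summable_on UNIV"
    "\<And>t::real. (\<Sum>\<^sub>\<infinity>m::int. 1 / (1 + \<bar>t - of_int m\<bar>)\<^sup>2) \<le> Q"
proof -
  define w where "w = (\<lambda>m::int. 4 * (1 / (1 + \<bar>real_of_int m\<bar>)\<^sup>2))"
  have w: "w summable_on UNIV"
    unfolding w_def by (intro summable_on_cmult_right summable_int_weight)
  have w0: "w m \<ge> 0" for m by (simp add: w_def)
  have bij: "bij_betw (\<lambda>m. m - \<lfloor>t\<rfloor>) UNIV UNIV" for t :: real
    by (rule bij_betwI[where g="\<lambda>m. m + \<lfloor>t\<rfloor>"]) auto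
  have wt: "(\<lambda>m. w (m - \<lfloor>t\<rfloor>)) summable_on UNIV" for t :: real
    using summable_on_reindex_bij_betw[OF bij, of w t] w by simp
  have le: "1 / (1 + \<bar>t - of_int m\<bar>)\<^sup>2 \<le> w (m - \<lfloor>t\<rfloor>)" for t :: real and m :: int
  proof -
    have "1 + \<bar>real_of_int (m - \<lfloor>t\<rfloor>)\<bar> \<le> 2 * (1 + \<bar>t - of_int m\<bar>)"
      using floor_correct[of t] by (simp add: abs_if split: if_splits) linarith
    then have "(1 + \<bar>real_of_int (m - \<lfloor>t\<rfloor>)\<bar>)\<^sup>2 \<le> (2 * (1 + \<bar>t - of_int m\<bar>))\<^sup>2"
      by (intro power_mono) auto
    then have "1 / (2 * (1 + \<bar>t - of_int m\<bar>))\<^sup>2 \<le> 1 / (1 + \<bar>real_of_int (m - \<lfloor>t\<rfloor>)\<bar>)\<^sup>2"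
      by (intro frac_le) auto
    moreover have "1 / (1 + \<bar>t - of_int m\<bar>)\<^sup>2 = 4 * (1 / (2 * (1 + \<bar>t - of_int m\<bar>))\<^sup>2)"
      unfolding power_mult_distrib by simp
    ultimately show ?thesis unfolding w_def by linarith
  qed
  have summ: "(\<lambda>m::int. 1 / (1 + \<bar>t - of_int m\<bar>)\<^sup>2) summable_on UNIV" for t :: real
    by (rule summable_on_comparison_test[OF wt[of t]]) (use le in auto)
  show ?thesis
  proof
    show "(\<Sum>\<^sub>\<infinity>m::int. 1 / (1 + \<bar>t - of_int m\<bar>)\<^sup>2) \<le> infsum w UNIV + 1" for t
    proof -
      have "(\<Sum>\<^sub>\<infinity>m::int. 1 / (1 + \<bar>t - of_int m\<bar>)\<^sup>2) \<le> (\<Sum>\<^sub>\<infinity>m. w (m - \<lfloor>t\<rfloor>))"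
        by (intro infsum_mono summ wt le)
      also have "\<dots> = infsum w UNIV"
        by (rule infsum_reindex_bij_betw[OF bij])
      finally show ?thesis by simp
    qed
    show "infsum w UNIV + 1 > 0"
      using infsum_nonneg[of UNIV w] w0 by (simp add: add_nonneg_pos)
  qed (rule summ)
qed

text \<open>The symmetric intervals eventually contain every finite set of integers, so an unordered
  sum may be evaluated along them, where telescoping applies.\<close>

lemma has_sum_int_imp_LIMSEQ_symmetric:
  fixes a :: "int \<Rightarrow> 'a :: {comm_monoid_add, topological_space}"
  assumes "(a has_sum s) UNIV"
  shows "(\<lambda>M. \<Sum>m\<in>{- int M..int M}. a m) \<longlonglongrightarrow> s"
proof -
  have "filterlim (\<lambda>M. {- int M..int M}) (finite_subsets_at_top UNIV) sequentially"
    unfolding filterlim_finite_subsets_at_top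
  proof (intro allI impI)
    fix X :: "int set" assume X: "finite X \<and> X \<subseteq> UNIV"
    \<comment> \<open>The sum of the absolute values bounds each of them, also when \<open>X\<close>
      is empty.\<close>
    define M0 where "M0 = (\<Sum>x\<in>X. nat \<bar>x\<bar>)"
    have "nat \<bar>x\<bar> \<le> M0" if "x \<in> X" for x
      unfolding M0_def by (rule member_le_sum) (use X that in auto)
    then have "X \<subseteq> {- int M..int M}" if "M \<ge> M0" for M
      using that by force
    then show "\<forall>\<^sub>F M in sequentially. finite {- int M..int M} \<and> X \<subseteq> {- int M..int M} \<and> {- int M..int M} \<subseteq> UNIV"
      by (auto simp: eventually_sequentially)
  qed
  with assms show ?thesis
    unfolding has_sum_def by (rule filterlim_compose)
qed

section \<open>Increments of a primitive\<close>

lemma sum_telescope_unit_steps: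
  fixes P :: "complex \<Rightarrow> complex"
  shows "(\<Sum>m\<in>{- int M..int M}. P (z - of_int m + 1/2) - P (z - of_int m - 1/2))
         = P (z + of_nat M + 1/2) - P (z - of_nat M - 1/2)"
proof (induction M)
  case (Suc M)
  have "{- int (Suc M)..int (Suc M)} = insert (int M + 1) (insert (- int M - 1) {- int M..int M})"
    by auto
  with Suc.IH show ?case by (simp add: algebra_simps)
qed simp

text \<open>Mean value inequality on a real segment of fixed length \<open>\<bar>t\<bar>\<close>
  that moves off to infinity: there \<open>g\<close> is at most
  \<open>C / (1 + \<bar>b\<bar> - \<bar>t\<bar>)\<close>, the exponential factor being 1 on the real
  axis. No limit of \<open>P\<close> itself enters.\<close>

lemma increment_tendsto_0:
  fixes P g :: "complex \<Rightarrow> complex"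
  assumes P: "\<And>z. (P has_field_derivative g z) (at z)"
    and C: "\<And>z. norm (g z) * (1 + \<bar>Re z\<bar>) \<le> C * exp (c * \<bar>Im z\<bar>)"
    and a: "filterlim (\<lambda>n. \<bar>a n\<bar>) at_top sequentially"
  shows "(\<lambda>n. P (of_real (t + a n)) - P (of_real (a n))) \<longlonglongrightarrow> 0"
proof -
  have bound: "norm (P (of_real (t + b)) - P (of_real b)) \<le> C / (1 + \<bar>b\<bar> - \<bar>t\<bar>) * \<bar>t\<bar>"
    if b: "\<bar>b\<bar> > \<bar>t\<bar>" for b :: real
  proof -
    have "norm (P (of_real (t + b)) - P (of_real b))
          \<le> C / (1 + \<bar>b\<bar> - \<bar>t\<bar>) * norm (complex_of_real (t + b) - of_real b)"
    proof (rule field_differentiable_bound[where S="of_real ` closed_segment b (t + b)"])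
      show "convex (complex_of_real ` closed_segment b (t + b))"
        by (intro convex_linear_image convex_closed_segment linear_of_real)
      fix z assume "z \<in> complex_of_real ` closed_segment b (t + b)"
      then obtain s where s: "z = of_real s" "s \<in> closed_segment b (t + b)" by blast
      then have "\<bar>s\<bar> \<ge> \<bar>b\<bar> - \<bar>t\<bar>"
        by (auto simp: closed_segment_eq_real_ivl split: if_splits)
      with b have "norm (g z) * (1 + \<bar>b\<bar> - \<bar>t\<bar>) \<le> norm (g z) * (1 + \<bar>s\<bar>)"
        by (intro mult_left_mono) auto
      also have "\<dots> \<le> C" using C[of z] s by simp
      finally show "norm (g z) \<le> C / (1 + \<bar>b\<bar> - \<bar>t\<bar>)"
        using b by (simp add: field_simps)
      show "(P has_field_derivative g z) (at z within of_real ` closed_segment b (t + b))"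
        by (rule DERIV_subset[OF P]) auto
    next
      show "complex_of_real (t + b) \<in> of_real ` closed_segment b (t + b)"
           "complex_of_real b \<in> of_real ` closed_segment b (t + b)"
        by (intro imageI; simp)+
    qed
    then show ?thesis by simp
  qed
  have "filterlim (\<lambda>n. (1 - \<bar>t\<bar>) + \<bar>a n\<bar>) at_top sequentially"
    by (rule filterlim_tendsto_add_at_top[OF tendsto_const a])
  then have "(\<lambda>n. C / ((1 - \<bar>t\<bar>) + \<bar>a n\<bar>) * \<bar>t\<bar>) \<longlonglongrightarrow> 0"
    by (intro tendsto_mult_left_zero real_tendsto_divide_at_top[OF tendsto_const])
  then have "(\<lambda>n. C / (1 + \<bar>a n\<bar> - \<bar>t\<bar>) * \<bar>t\<bar>) \<longlonglongrightarrow> 0"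
    by (simp add: algebra_simps)
  moreover have "\<forall>\<^sub>F n in sequentially. \<bar>a n\<bar> > \<bar>t\<bar>"
    using a by (simp add: filterlim_at_top_dense)
  then have "\<forall>\<^sub>F n in sequentially. norm (P (of_real (t + a n)) - P (of_real (a n)))
              \<le> C / (1 + \<bar>a n\<bar> - \<bar>t\<bar>) * \<bar>t\<bar>"
    by eventually_elim (rule bound)
  ultimately show ?thesis
    by (rule Lim_null_comparison[rotated])
qed

text \<open>All points involved lie on a horizontal segment of length 1 centred at \<open>z\<close>.
  Along it the imaginary part is constant, so the exponential factor is kept, and
  \<open>1 + \<bar>Re z\<bar>\<close> exceeds \<open>1 + \<bar>Re w\<bar>\<close> by a factor of at
  most 2.\<close>

lemma unit_increment_bound:
  fixes P g :: "complex \<Rightarrow> complex"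
  assumes P: "\<And>z. (P has_field_derivative g z) (at z)"
    and C: "\<And>z. norm (g z) * (1 + \<bar>Re z\<bar>) ^ N \<le> C * exp (c * \<bar>Im z\<bar>)"
  shows "norm (g (z + 1/2)) * (1 + \<bar>Re z\<bar>) ^ N \<le> 2 ^ N * C * exp (c * \<bar>Im z\<bar>)"
    and "norm (g (z - 1/2)) * (1 + \<bar>Re z\<bar>) ^ N \<le> 2 ^ N * C * exp (c * \<bar>Im z\<bar>)"
    and "norm (P (z + 1/2) - P (z - 1/2)) * (1 + \<bar>Re z\<bar>) ^ N \<le> 2 ^ N * C * exp (c * \<bar>Im z\<bar>)"
proof -
  define S where "S = {w. Im w = Im z \<and> Re z - 1/2 \<le> Re w \<and> Re w \<le> Re z + 1/2}"
  have S: "z + 1/2 \<in> S" "z - 1/2 \<in> S"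
    by (auto simp: S_def)
  have g: "norm (g w) * (1 + \<bar>Re z\<bar>) ^ N \<le> 2 ^ N * C * exp (c * \<bar>Im z\<bar>)" if "w \<in> S" for w
  proof -
    have "Im w = Im z" "Re z - 1/2 \<le> Re w" "Re w \<le> Re z + 1/2"
      using that by (simp_all add: S_def)
    then have "1 + \<bar>Re z\<bar> \<le> 2 * (1 + \<bar>Re w\<bar>)"
      by (smt (verit) field_sum_of_halves)
    then have "norm (g w) * (1 + \<bar>Re z\<bar>) ^ N \<le> norm (g w) * (2 * (1 + \<bar>Re w\<bar>)) ^ N"
      by (intro mult_left_mono power_mono) auto
    also have "\<dots> \<le> 2 ^ N * (C * exp (c * \<bar>Im z\<bar>))"
      using C[of w] that unfolding power_mult_distrib by (simp add: S_def)
    finally show ?thesis by simp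
  qed
  from g S show "norm (g (z + 1/2)) * (1 + \<bar>Re z\<bar>) ^ N \<le> 2 ^ N * C * exp (c * \<bar>Im z\<bar>)"
    and "norm (g (z - 1/2)) * (1 + \<bar>Re z\<bar>) ^ N \<le> 2 ^ N * C * exp (c * \<bar>Im z\<bar>)"
    by blast+
  have pos: "(1 + \<bar>Re z\<bar>) ^ N > 0" by (simp add: add_pos_nonneg)
  have "norm (P (z + 1/2) - P (z - 1/2))
        \<le> 2 ^ N * C * exp (c * \<bar>Im z\<bar>) / (1 + \<bar>Re z\<bar>) ^ N * norm ((z + 1/2) - (z - 1/2))"
  proof (rule field_differentiable_bound)
    have "S = Im -` {Im z} \<inter> Re -` {Re z - 1/2..Re z + 1/2}"
      by (auto simp: S_def)
    moreover have "convex (Im -` {Im z})" "convex (Re -` {Re z - 1/2..Re z + 1/2})"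
      by (intro convex_linear_vimage bounded_linear.linear bounded_linear_Im bounded_linear_Re; simp)+
    ultimately show "convex S"
      by (simp add: convex_Int)
    show "(P has_field_derivative g w) (at w within S)" for w
      by (rule DERIV_subset[OF P]) auto
    show "norm (g w) \<le> 2 ^ N * C * exp (c * \<bar>Im z\<bar>) / (1 + \<bar>Re z\<bar>) ^ N" if "w \<in> S" for w
      using g[OF that] pos by (simp add: pos_le_divide_eq)
  qed (use S in auto)
  then show "norm (P (z + 1/2) - P (z - 1/2)) * (1 + \<bar>Re z\<bar>) ^ N \<le> 2 ^ N * C * exp (c * \<bar>Im z\<bar>)"
    using pos by (simp add: pos_le_divide_eq)
qed

text \<open>Squaring doubles the exponential type, hence the scaling by \<open>c / 2\<close> to
  reach type \<open>c\<close>. One factor of the square supplies the decay, the other only its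
  exponential bound.\<close>

lemma scaled_up_transform_decay:
  assumes c: "c > 0"
  defines "g \<equiv> \<lambda>z. (up_transform (of_real (c / 2) * z))\<^sup>2"
  shows "\<exists>C>0. \<forall>z. norm (g z) * (1 + \<bar>Re z\<bar>) ^ N \<le> C * exp (c * \<bar>Im z\<bar>)"
proof -
  obtain C0 where C0: "C0 > 0" "\<And>z. norm (up_transform z) \<le> C0 * exp \<bar>Im z\<bar>"
    using up_transform_decay[of 0] by auto
  obtain C where C: "C > 0" "\<And>z. norm (up_transform z) * (1 + \<bar>Re z\<bar>) ^ N \<le> C * exp \<bar>Im z\<bar>"
    using up_transform_decay[of N] by auto
  \<comment> \<open>Chosen so that \<open>1 + a \<le> L * (1 + c / 2 * a)\<close> for
    \<open>a \<ge> 0\<close>.\<close>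
  define L where "L = 1 + 2 / c"
  have L: "L > 0" using c by (simp add: L_def add_pos_nonneg)
  show ?thesis
  proof (intro exI conjI allI)
    fix z :: complex
    define w where "w = of_real (c / 2) * z"
    have Re: "Re w = c / 2 * Re z" and Im: "\<bar>Im w\<bar> + \<bar>Im w\<bar> = c * \<bar>Im z\<bar>"
      using c by (auto simp: w_def abs_mult)
    have le: "1 + \<bar>Re z\<bar> \<le> L * (1 + \<bar>Re w\<bar>)"
      using c by (simp add: Re abs_mult L_def field_simps)
    have "norm (g z) * (1 + \<bar>Re z\<bar>) ^ N \<le> norm (g z) * (L * (1 + \<bar>Re w\<bar>)) ^ N"
      by (intro mult_left_mono power_mono le) auto
    also have "\<dots> = L ^ N * (norm (up_transform w) * (norm (up_transform w) * (1 + \<bar>Re w\<bar>) ^ N))"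
      by (simp add: g_def w_def norm_power power2_eq_square power_mult_distrib norm_mult)
    also have "\<dots> \<le> L ^ N * ((C0 * exp \<bar>Im w\<bar>) * (C * exp \<bar>Im w\<bar>))"
      using L C0(1) by (intro mult_left_mono mult_mono C0(2) C(2)) auto
    also have "\<dots> = (L ^ N * C0 * C) * exp (\<bar>Im w\<bar> + \<bar>Im w\<bar>)"
      by (simp only: exp_add mult_ac)
    finally show "norm (g z) * (1 + \<bar>Re z\<bar>) ^ N \<le> (L ^ N * C0 * C) * exp (c * \<bar>Im z\<bar>)"
      by (simp only: Im)
    show "L ^ N * C0 * C > 0" using L C0 C by simp
  qed
qed

text \<open>Unit increments of a primitive inherit the type and decay of \<open>g\<close>, are
  nonnegative where \<open>g\<close> is, and have telescoping translates. What remains is that the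
  sum of the translates is a positive constant, by which one can divide.\<close>

lemma partition_of_unity_kernel:
  assumes c: "c > 0"
  obtains k k' :: "complex \<Rightarrow> complex" where
    "\<And>z. (k has_field_derivative k' z) (at z)"
    "\<And>x::real. k (of_real x) \<in> \<real>"
    "\<And>x::real. Re (k (of_real x)) \<ge> 0"
    "\<And>N. \<exists>C. \<forall>z. norm (k z) * (1 + \<bar>Re z\<bar>) ^ N \<le> C * exp (c * \<bar>Im z\<bar>)
                   \<and> norm (k' z) * (1 + \<bar>Re z\<bar>) ^ N \<le> C * exp (c * \<bar>Im z\<bar>)"
    "\<And>x::real. ((\<lambda>m::int. k (of_real (x - of_int m))) has_sum 1) UNIV"
proof -
  define g where "g = (\<lambda>z. (up_transform (of_real (c / 2) * z))\<^sup>2)"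
  have "up_transform \<circ> (\<lambda>z. of_real (c / 2) * z) holomorphic_on UNIV"
    by (rule holomorphic_on_compose_gen[OF _ up_transform_holomorphic]) (auto intro!: holomorphic_intros)
  then have "g holomorphic_on UNIV"
    unfolding g_def o_def by (intro holomorphic_intros)
  then obtain P where P: "\<And>z. (P has_field_derivative g z) (at z)"
    using holomorphic_convex_primitive'[of UNIV g] by auto
  have g_decay: "\<exists>C>0. \<forall>z. norm (g z) * (1 + \<bar>Re z\<bar>) ^ N \<le> C * exp (c * \<bar>Im z\<bar>)" for N
    unfolding g_def by (rule scaled_up_transform_decay[OF c])
  have g_real: "Im (g (of_real x)) = 0" and g_nonneg: "Re (g (of_real x)) \<ge> 0" for x :: real
  proof -
    have "up_transform (of_real (c / 2) * of_real x) \<in> \<real>"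
      by (intro up_transform_in_Reals) auto
    then obtain u :: real where "up_transform (of_real (c / 2) * of_real x) = of_real u"
      by (rule Reals_cases)
    then have "g (of_real x) = of_real (u\<^sup>2)"
      by (simp add: g_def)
    then show "Im (g (of_real x)) = 0" "Re (g (of_real x)) \<ge> 0" by simp_all
  qed
  have g0: "g 0 = 1" by (simp add: g_def up_transform_0)

  \<comment> \<open>On the real axis \<open>g\<close> is real and nonnegative, so there
    \<open>P\<close> has constant imaginary part and nondecreasing real part.\<close>
  have vder: "((\<lambda>x. P (of_real x)) has_vector_derivative g (of_real x)) (at x)" for x :: real
    by (intro has_vector_derivative_real_field P)
  have dRe: "((\<lambda>x. Re (P (of_real x))) has_field_derivative Re (g (of_real x))) (at x)" for x :: real
    by (intro has_field_derivative_Re vder)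
  have dIm: "((\<lambda>x. Im (P (of_real x))) has_field_derivative 0) (at x)" for x :: real
    using has_field_derivative_Im[OF vder[of x]] by (simp add: g_real)
  have Im_P: "Im (P (of_real x)) = Im (P (of_real y))" for x y :: real
    by (rule DERIV_isconst_all) (use dIm in auto)
  have Re_P: "Re (P (of_real x)) \<le> Re (P (of_real y))" if "x \<le> y" for x y :: real
    by (rule DERIV_nonneg_imp_nondecreasing[OF that]) (use dRe g_nonneg in blast)

  define k where "k = (\<lambda>z. P (z + 1/2) - P (z - 1/2))"
  define k' where "k' = (\<lambda>z. g (z + 1/2) - g (z - 1/2))"
  have k_der: "(k has_field_derivative k' z) (at z)" for z
    unfolding k_def k'_def by (auto intro!: derivative_eq_intros DERIV_chain2[OF P])
  have k_of_real: "k (of_real x) = P (of_real (x + 1/2)) - P (of_real (x - 1/2))" for x :: real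
    by (simp add: k_def)
  have k_real: "Im (k (of_real x)) = 0" for x :: real
    unfolding k_of_real using Im_P[of "x + 1/2" "x - 1/2"] by simp
  have k_nonneg: "Re (k (of_real x)) \<ge> 0" for x :: real
    unfolding k_of_real using Re_P[of "x - 1/2" "x + 1/2"] by simp
  have k_decay: "\<exists>C. \<forall>z. norm (k z) * (1 + \<bar>Re z\<bar>) ^ N \<le> C * exp (c * \<bar>Im z\<bar>)
                   \<and> norm (k' z) * (1 + \<bar>Re z\<bar>) ^ N \<le> C * exp (c * \<bar>Im z\<bar>)" for N
  proof -
    obtain C where C: "C > 0" "\<And>z. norm (g z) * (1 + \<bar>Re z\<bar>) ^ N \<le> C * exp (c * \<bar>Im z\<bar>)"
      using g_decay[of N] by blast
    have "norm (k z) * (1 + \<bar>Re z\<bar>) ^ N \<le> (2 * 2 ^ N * C) * exp (c * \<bar>Im z\<bar>)" for z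
    proof -
      have "0 \<le> 2 ^ N * C * exp (c * \<bar>Im z\<bar>)" using C(1) by simp
      with unit_increment_bound(3)[OF P C(2), of z] show ?thesis unfolding k_def by linarith
    qed
    moreover have "norm (k' z) * (1 + \<bar>Re z\<bar>) ^ N \<le> (2 * 2 ^ N * C) * exp (c * \<bar>Im z\<bar>)" for z
    proof -
      have "norm (k' z) * (1 + \<bar>Re z\<bar>) ^ N
            \<le> (norm (g (z + 1/2)) + norm (g (z - 1/2))) * (1 + \<bar>Re z\<bar>) ^ N"
        unfolding k'_def by (intro mult_right_mono norm_triangle_ineq4) auto
      with unit_increment_bound(1,2)[OF P C(2), of z] show ?thesis
        unfolding distrib_right by linarith
    qed
    ultimately show ?thesis by blast
  qed

  obtain Q where Q: "\<And>t::real. (\<lambda>m::int. 1 / (1 + \<bar>t - of_int m\<bar>)\<^sup>2) summable_on UNIV"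
    using lattice_weight_bounded by blast
  have k_abs: "(\<lambda>m::int. norm (k (of_real (x - of_int m)))) summable_on UNIV" for x :: real
  proof -
    obtain C where C: "\<And>z. norm (k z) * (1 + \<bar>Re z\<bar>)\<^sup>2 \<le> C * exp (c * \<bar>Im z\<bar>)"
      using k_decay[of 2] by blast
    show ?thesis
    proof (rule summable_on_comparison_test)
      show "(\<lambda>m::int. C * (1 / (1 + \<bar>x - of_int m\<bar>)\<^sup>2)) summable_on UNIV"
        by (intro summable_on_cmult_right Q)
      show "norm (k (of_real (x - of_int m))) \<le> C * (1 / (1 + \<bar>x - of_int m\<bar>)\<^sup>2)" for m
        using C[of "of_real (x - of_int m)"]
        by (simp add: pos_le_divide_eq add_pos_nonneg)
    qed auto
  qed
  define s where "s = (\<lambda>x::real. \<Sum>\<^sub>\<infinity>m::int. k (of_real (x - of_int m)))"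
  have s: "((\<lambda>m::int. k (of_real (x - of_int m))) has_sum s x) UNIV" for x
    unfolding s_def by (rule has_sum_infsum[OF Infinite_Sum.abs_summable_summable[OF k_abs]])
  have s_lim: "(\<lambda>M. P (of_real (x + (real M + 1/2))) - P (of_real (x + - (real M + 1/2)))) \<longlonglongrightarrow> s x" for x
  proof -
    have "(\<Sum>m\<in>{- int M..int M}. k (of_real (x - of_int m)))
          = P (of_real (x + (real M + 1/2))) - P (of_real (x + - (real M + 1/2)))" for M
      using sum_telescope_unit_steps[of P "of_real x" M] by (simp add: k_def algebra_simps)
    with has_sum_int_imp_LIMSEQ_symmetric[OF s[of x]] show ?thesis by simp
  qed
  \<comment> \<open>The partial sums at \<open>x\<close> and at 0 differ by two increments of
    \<open>P\<close> of length \<open>x\<close>, based at \<open>real M + 1/2\<close> and at its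
    negative; both vanish in the limit.\<close>
  have s_const: "s x = s 0" for x
  proof (rule LIMSEQ_unique[OF s_lim])
    obtain C where C: "\<And>z. norm (g z) * (1 + \<bar>Re z\<bar>) \<le> C * exp (c * \<bar>Im z\<bar>)"
      using g_decay[of 1] by auto
    have top: "filterlim (\<lambda>M. \<bar>real M + 1/2\<bar>) at_top sequentially"
      "filterlim (\<lambda>M. \<bar>- (real M + 1/2)\<bar>) at_top sequentially"
      by real_asymp+
    have "(\<lambda>M. (P (of_real (x + (real M + 1/2))) - P (of_real (real M + 1/2)))
            - (P (of_real (x + - (real M + 1/2))) - P (of_real (- (real M + 1/2))))
            + (P (of_real (0 + (real M + 1/2))) - P (of_real (0 + - (real M + 1/2))))) \<longlonglongrightarrow> 0 - 0 + s 0"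
      by (intro tendsto_intros increment_tendsto_0[OF P C] top s_lim)
    then show "(\<lambda>M. P (of_real (x + (real M + 1/2))) - P (of_real (x + - (real M + 1/2)))) \<longlonglongrightarrow> s 0"
      by simp
  qed
  have Im_s: "Im (s 0) = 0"
    using has_sum_unique[OF has_sum_Im[OF s[of 0]], of 0] by (simp only: k_real has_sum_0_simp)
  \<comment> \<open>Otherwise the monotone function \<open>Re P\<close> would be constant on the
    interval from -1/2 to 1/2, against \<open>g 0 = 1\<close>.\<close>
  have "Re (k 0) \<noteq> 0"
  proof
    assume "Re (k 0) = 0"
    then have eq: "Re (P (of_real (1/2))) = Re (P (of_real (- 1/2)))"
      using k_of_real[of 0] by simp
    have "Re (P (of_real 0)) = Re (P (of_real y))" if "\<bar>0 - y\<bar> < 1/2" for y :: real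
    proof -
      have "- 1/2 \<le> y" "y \<le> 1/2" using that by auto
      then have "Re (P (of_real y)) = Re (P (of_real (- 1/2)))"
        using Re_P[of "- 1/2" y] Re_P[of y "1/2"] eq by linarith
      moreover have "Re (P (of_real 0)) = Re (P (of_real (- 1/2)))"
        using Re_P[of "- 1/2" 0] Re_P[of 0 "1/2"] eq by simp
      ultimately show ?thesis by simp
    qed
    then have "Re (g (of_real 0)) = 0"
      by (intro DERIV_local_const[OF dRe, of "1/2"]) auto
    with g0 show False by simp
  qed
  moreover have "Re (k 0) \<le> Re (s 0)"
    using finite_sum_le_has_sum[OF has_sum_Re[OF s[of 0]] _ _ k_nonneg, of "{0}"] by simp
  ultimately have s0: "Re (s 0) > 0"
    using k_nonneg[of 0] by simp
  define \<sigma> where "\<sigma> = Re (s 0)"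
  have \<sigma>: "\<sigma> > 0" "s x = of_real \<sigma>" for x
    using s0 Im_s unfolding s_const[of x] by (auto simp: \<sigma>_def complex_eq_iff)

  show ?thesis
  proof (rule that[of "\<lambda>z. k z / of_real \<sigma>" "\<lambda>z. k' z / of_real \<sigma>"])
    show "((\<lambda>z. k z / of_real \<sigma>) has_field_derivative k' z / of_real \<sigma>) (at z)" for z
      by (rule DERIV_cdivide[OF k_der])
    show "k (of_real x) / of_real \<sigma> \<in> \<real>" for x :: real
      by (simp add: complex_is_Real_iff k_real)
    show "Re (k (of_real x) / of_real \<sigma>) \<ge> 0" for x :: real
      using k_nonneg \<sigma> by simp
    show "((\<lambda>m. k (of_real (x - of_int m)) / of_real \<sigma>) has_sum 1) UNIV" for x
      using has_sum_divide_const[OF s[of x], of "of_real \<sigma>"] \<sigma> by simp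
    show "\<exists>C. \<forall>z. norm (k z / of_real \<sigma>) * (1 + \<bar>Re z\<bar>) ^ N \<le> C * exp (c * \<bar>Im z\<bar>)
                   \<and> norm (k' z / of_real \<sigma>) * (1 + \<bar>Re z\<bar>) ^ N \<le> C * exp (c * \<bar>Im z\<bar>)" for N
    proof -
      obtain C where "\<And>z. norm (k z) * (1 + \<bar>Re z\<bar>) ^ N \<le> C * exp (c * \<bar>Im z\<bar>)"
        "\<And>z. norm (k' z) * (1 + \<bar>Re z\<bar>) ^ N \<le> C * exp (c * \<bar>Im z\<bar>)"
        using k_decay[of N] by blast
      with \<sigma>(1) show ?thesis
        by (intro exI[of _ "C / \<sigma>"]) (simp add: norm_divide divide_right_mono)
    qed
  qed
qed

section \<open>Lattice series in several variables\<close>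

text \<open>Every finite set of multi-indices lies in the box spanned by its coordinate projections,
  and over a box the sum of products factors. This bounds the partial sums of the nonnegative
  series.\<close>

lemma
  fixes f :: "'n::finite \<Rightarrow> 'a \<Rightarrow> real"
  assumes nonneg: "\<And>j m. f j m \<ge> 0" and summ: "\<And>j. f j summable_on UNIV"
  shows summable_on_prod_fun: "(\<lambda>\<nu>. \<Prod>j\<in>UNIV. f j (\<nu> j)) summable_on UNIV"
    and infsum_prod_fun: "(\<Sum>\<^sub>\<infinity>\<nu>. \<Prod>j\<in>UNIV. f j (\<nu> j)) = (\<Prod>j\<in>UNIV. infsum (f j) UNIV)"
proof -
  show *: "(\<lambda>\<nu>. \<Prod>j\<in>UNIV. f j (\<nu> j)) summable_on UNIV"
  proof (rule nonneg_bdd_above_summable_on)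
    show "bdd_above (sum (\<lambda>\<nu>. \<Prod>j\<in>UNIV. f j (\<nu> j)) ` {F. F \<subseteq> UNIV \<and> finite F})"
    proof (rule bdd_aboveI2)
      fix F :: "('n \<Rightarrow> 'a) set" assume F: "F \<in> {F. F \<subseteq> UNIV \<and> finite F}"
      define B where "B = (\<lambda>j. (\<lambda>\<nu>. \<nu> j) ` F)"
      have fin: "finite (B j)" for j using F by (simp add: B_def)
      have "(\<Sum>\<nu>\<in>F. \<Prod>j\<in>UNIV. f j (\<nu> j)) \<le> (\<Sum>\<nu>\<in>Pi\<^sub>E UNIV B. \<Prod>j\<in>UNIV. f j (\<nu> j))"
        by (rule sum_mono2) (auto simp: B_def nonneg intro!: prod_nonneg finite_PiE fin[unfolded B_def])
      also have "\<dots> = (\<Prod>j\<in>UNIV. \<Sum>m\<in>B j. f j m)"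
        by (rule prod_sum_PiE[symmetric]) (auto simp: fin)
      also have "\<dots> \<le> (\<Prod>j\<in>UNIV. infsum (f j) UNIV)"
        by (intro prod_mono conjI sum_nonneg nonneg finite_sum_le_infsum summ fin) auto
      finally show "(\<Sum>\<nu>\<in>F. \<Prod>j\<in>UNIV. f j (\<nu> j)) \<le> (\<Prod>j\<in>UNIV. infsum (f j) UNIV)" .
    qed
  qed (auto intro!: prod_nonneg nonneg)
  show "(\<Sum>\<^sub>\<infinity>\<nu>. \<Prod>j\<in>UNIV. f j (\<nu> j)) = (\<Prod>j\<in>UNIV. infsum (f j) UNIV)"
    using infsum_prod_PiE[of UNIV f "\<lambda>_. UNIV"] summ * by (simp add: PiE_UNIV_domain)
qed

text \<open>Expanding the product only adds nonnegative terms. Together with the bound of the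
  Euclidean norm by the sum of the coordinates it lets decay in the norm be paid for coordinate by
  coordinate.\<close>

lemma one_plus_sum_le_prod:
  fixes a :: "'i \<Rightarrow> real"
  assumes "finite A" "\<And>i. a i \<ge> 0"
  shows "1 + (\<Sum>i\<in>A. a i) \<le> (\<Prod>i\<in>A. 1 + a i)"
  using assms(1)
proof (induction rule: finite_induct)
  case (insert x A)
  have "1 + (\<Sum>i\<in>insert x A. a i) \<le> (1 + (\<Sum>i\<in>A. a i)) + a x * (1 + (\<Sum>i\<in>A. a i))"
    using insert.hyps assms(2) by (simp add: distrib_left sum_nonneg)
  also have "\<dots> = (1 + a x) * (1 + (\<Sum>i\<in>A. a i))" by (simp add: algebra_simps)
  also have "\<dots> \<le> (1 + a x) * (\<Prod>i\<in>A. 1 + a i)"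
    by (intro mult_left_mono insert.IH) (simp add: assms(2))
  finally show ?case using insert.hyps by simp
qed simp

text \<open>The common summable majorant for the kernel and for its derivative.\<close>

definition lattice_weight :: "real ^ 'n \<Rightarrow> ('n \<Rightarrow> int) \<Rightarrow> real" where
  "lattice_weight x \<nu> = (\<Prod>j\<in>UNIV. 1 / (1 + \<bar>x $ j - of_int (\<nu> j)\<bar>)\<^sup>2)"

lemma lattice_weight_nonneg: "lattice_weight x \<nu> \<ge> 0"
  by (auto simp: lattice_weight_def intro!: prod_nonneg)

lemma lattice_weight_sum_bounded:
  obtains Q :: real where "Q > 0"
    "\<And>x :: real ^ 'n. lattice_weight x summable_on UNIV"
    "\<And>x :: real ^ 'n. infsum (lattice_weight x) UNIV \<le> Q"
proof -
  obtain Q :: real where Q: "Q > 0"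
    "\<And>t::real. (\<lambda>m::int. 1 / (1 + \<bar>t - of_int m\<bar>)\<^sup>2) summable_on UNIV"
    "\<And>t::real. (\<Sum>\<^sub>\<infinity>m::int. 1 / (1 + \<bar>t - of_int m\<bar>)\<^sup>2) \<le> Q"
    by (rule lattice_weight_bounded) (rule that)
  show ?thesis
  proof (rule that[of "Q ^ CARD('n)"])
    fix x :: "real ^ 'n"
    show "lattice_weight x summable_on UNIV"
      unfolding lattice_weight_def by (rule summable_on_prod_fun) (auto intro: Q)
    have "infsum (lattice_weight x) UNIV = (\<Prod>j\<in>UNIV. \<Sum>\<^sub>\<infinity>m::int. 1 / (1 + \<bar>x $ j - of_int m\<bar>)\<^sup>2)"
      unfolding lattice_weight_def by (rule infsum_prod_fun) (auto intro: Q)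
    also have "\<dots> \<le> (\<Prod>j\<in>(UNIV::'n set). Q)"
      by (intro prod_mono conjI Q(3) infsum_nonneg) auto
    finally show "infsum (lattice_weight x) UNIV \<le> Q ^ CARD('n)" by simp
  qed (use Q in auto)
qed

section \<open>The tensor kernel: decay, derivative and tails\<close>

definition lattice_vec :: "('n \<Rightarrow> int) \<Rightarrow> real ^ 'n" where
  "lattice_vec \<nu> = (\<chi> j. of_int (\<nu> j))"

definition tensor_kernel :: "(complex \<Rightarrow> complex) \<Rightarrow> complex ^ 'n \<Rightarrow> ('n \<Rightarrow> int) \<Rightarrow> complex" where
  "tensor_kernel k z \<nu> = (\<Prod>j\<in>UNIV. k (z $ j - of_int (\<nu> j)))"

definition tensor_kernel_deriv ::
    "(complex \<Rightarrow> complex) \<Rightarrow> (complex \<Rightarrow> complex) \<Rightarrow> complex ^ 'n \<Rightarrow> ('n \<Rightarrow> int) \<Rightarrow> complex ^ 'n \<Rightarrow> complex" where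
  "tensor_kernel_deriv k k' z \<nu> v =
     (\<Sum>i\<in>UNIV. k' (z $ i - of_int (\<nu> i)) * v $ i * (\<Prod>j\<in>UNIV - {i}. k (z $ j - of_int (\<nu> j))))"

text \<open>Collects what \<open>partition_of_unity_kernel\<close> provides for
  \<open>c > 0\<close>. Type \<open>c\<close> in each variable yields type
  \<open>c * CARD('n)\<close> for the tensor product, since every \<open>\<bar>y $ j\<bar>\<close>
  is bounded by \<open>norm y\<close>.\<close>

locale partition_kernel =
  fixes k k' :: "complex \<Rightarrow> complex" and c :: real
  assumes c_pos: "c > 0"
    and k_deriv: "\<And>z. (k has_field_derivative k' z) (at z)"
    and k_real: "\<And>x::real. k (of_real x) \<in> \<real>"
    and k_nonneg: "\<And>x::real. Re (k (of_real x)) \<ge> 0"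
    and k_decay: "\<And>N. \<exists>C. \<forall>z. norm (k z) * (1 + \<bar>Re z\<bar>) ^ N \<le> C * exp (c * \<bar>Im z\<bar>)
                   \<and> norm (k' z) * (1 + \<bar>Re z\<bar>) ^ N \<le> C * exp (c * \<bar>Im z\<bar>)"
    and k_sum: "\<And>x::real. ((\<lambda>m::int. k (of_real (x - of_int m))) has_sum 1) UNIV"
begin

lemma k_decay_pos:
  obtains C where "C > 0"
    "\<And>z. norm (k z) * (1 + \<bar>Re z\<bar>) ^ N \<le> C * exp (c * \<bar>Im z\<bar>)"
    "\<And>z. norm (k' z) * (1 + \<bar>Re z\<bar>) ^ N \<le> C * exp (c * \<bar>Im z\<bar>)"
proof -
  obtain C where C: "\<And>z. norm (k z) * (1 + \<bar>Re z\<bar>) ^ N \<le> C * exp (c * \<bar>Im z\<bar>)"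
    "\<And>z. norm (k' z) * (1 + \<bar>Re z\<bar>) ^ N \<le> C * exp (c * \<bar>Im z\<bar>)"
    using k_decay[of N] by blast
  have le: "C * exp (c * \<bar>Im z\<bar>) \<le> (\<bar>C\<bar> + 1) * exp (c * \<bar>Im z\<bar>)" for z :: complex
    by (intro mult_right_mono) auto
  show ?thesis
    by (rule that[of "\<bar>C\<bar> + 1"]) (auto intro: order_trans[OF C(1) le] order_trans[OF C(2) le])
qed

text \<open>Of the \<open>N + 2\<close> powers of decay available in each variable, \<open>N\<close>
  together dominate the power of the norm and 2 are kept for the summable weight.\<close>

lemma tensor_kernel_decay:
  obtains C where "C > 0"
    "\<And>(x :: real ^ 'n) y \<nu>. norm (tensor_kernel k (cvec x y) \<nu>) * (1 + norm (x - lattice_vec \<nu>)) ^ N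
        \<le> C * exp (c * CARD('n) * norm y) * lattice_weight x \<nu>"
proof -
  obtain C where C: "C > 0"
    "\<And>z. norm (k z) * (1 + \<bar>Re z\<bar>) ^ (N + 2) \<le> C * exp (c * \<bar>Im z\<bar>)"
    by (rule k_decay_pos[of "N + 2"]) blast
  show ?thesis
  proof (rule that[of "C ^ CARD('n)"])
    fix x y :: "real ^ 'n" and \<nu>
    define u where "u = (\<lambda>j. \<bar>x $ j - of_int (\<nu> j)\<bar>)"
    have "norm (x - lattice_vec \<nu>) \<le> (\<Sum>j\<in>UNIV. u j)"
      using norm_le_l1_cart[of "x - lattice_vec \<nu>"] by (simp add: u_def lattice_vec_def)
    then have le: "1 + norm (x - lattice_vec \<nu>) \<le> (\<Prod>j\<in>UNIV. 1 + u j)"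
      using one_plus_sum_le_prod[of UNIV u] by (simp add: u_def)
    have "norm (tensor_kernel k (cvec x y) \<nu>) * (1 + norm (x - lattice_vec \<nu>)) ^ N
          \<le> norm (tensor_kernel k (cvec x y) \<nu>) * (\<Prod>j\<in>UNIV. 1 + u j) ^ N"
      by (intro mult_left_mono power_mono le) auto
    also have "\<dots> = (\<Prod>j\<in>UNIV. norm (k (cvec x y $ j - of_int (\<nu> j))) * (1 + u j) ^ N)"
      by (simp add: tensor_kernel_def prod_norm prod.distrib prod_power_distrib)
    also have "\<dots> \<le> (\<Prod>j\<in>(UNIV :: 'n set). C * exp (c * norm y) * (1 / (1 + u j)\<^sup>2))"
    proof (intro prod_mono conjI)
      fix j
      have "norm (k (cvec x y $ j - of_int (\<nu> j))) * (1 + u j) ^ (N + 2) \<le> C * exp (c * \<bar>y $ j\<bar>)"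
        using C(2)[of "cvec x y $ j - of_int (\<nu> j)"] by (simp add: cvec_def u_def)
      also have "\<dots> \<le> C * exp (c * norm y)"
        using C(1) c_pos component_le_norm_cart[of y j] by simp
      finally show "norm (k (cvec x y $ j - of_int (\<nu> j))) * (1 + u j) ^ N \<le> C * exp (c * norm y) * (1 / (1 + u j)\<^sup>2)"
        unfolding power_add by (simp add: pos_le_divide_eq u_def add_pos_nonneg mult.assoc)
    qed (auto simp: u_def)
    also have "\<dots> = C ^ CARD('n) * exp (c * norm y) ^ CARD('n) * lattice_weight x \<nu>"
      by (simp only: prod.distrib prod_constant lattice_weight_def u_def power_mult_distrib)
    also have "exp (c * norm y) ^ CARD('n) = exp (c * CARD('n) * norm y)"
      by (simp add: mult_ac flip: exp_of_nat_mult)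
    finally show "norm (tensor_kernel k (cvec x y) \<nu>) * (1 + norm (x - lattice_vec \<nu>)) ^ N
        \<le> C ^ CARD('n) * exp (c * CARD('n) * norm y) * lattice_weight x \<nu>" .
  qed (use C in auto)
qed

lemma tensor_kernel_has_derivative:
  "((\<lambda>z. tensor_kernel k z \<nu>) has_derivative tensor_kernel_deriv k k' z \<nu>) (at z)"
proof -
  have "((\<lambda>z. k (z $ j - of_int (\<nu> j))) has_derivative (\<lambda>v. k' (z $ j - of_int (\<nu> j)) * v $ j)) (at z)" for j
  proof -
    have "((\<lambda>z. z $ j - of_int (\<nu> j)) has_derivative (\<lambda>v. v $ j)) (at z)"
      by (auto intro!: derivative_eq_intros bounded_linear_imp_has_derivative bounded_linear_vec_nth)
    from has_derivative_compose[OF this k_deriv[unfolded has_field_derivative_def]]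
    show ?thesis by simp
  qed
  then show ?thesis
    unfolding tensor_kernel_def tensor_kernel_deriv_def by (rule has_derivative_prod)
qed

text \<open>The weight is centred at 0 and not at the moving point: on a fixed ball this gives a
  majorant independent of \<open>z\<close>, as termwise differentiation requires.\<close>

lemma tensor_kernel_deriv_bound:
  obtains C where "C > 0"
    "\<And>(z :: complex ^ 'n) \<nu> v. norm z \<le> \<rho> \<Longrightarrow>
       norm (tensor_kernel_deriv k k' z \<nu> v) \<le> C * lattice_weight 0 \<nu> * norm v"
proof (cases "\<rho> \<ge> 0")
  case True
  obtain C0 where C0: "C0 > 0"
    "\<And>z. norm (k z) * (1 + \<bar>Re z\<bar>)\<^sup>2 \<le> C0 * exp (c * \<bar>Im z\<bar>)"
    "\<And>z. norm (k' z) * (1 + \<bar>Re z\<bar>)\<^sup>2 \<le> C0 * exp (c * \<bar>Im z\<bar>)"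
    by (rule k_decay_pos[of 2]) blast
  define C1 where "C1 = C0 * exp (c * \<rho>) * (1 + \<rho>)\<^sup>2"
  have C1: "C1 > 0" using C0 True by (simp add: C1_def add_pos_nonneg)
  \<comment> \<open>Moving the centre of the weight from \<open>Re w\<close> to 0 costs the factor
    \<open>(1 + \<rho>)\<^sup>2\<close>, which is built into \<open>C1\<close>.\<close>
  have transfer: "h \<le> C1 * (1 / (1 + \<bar>real_of_int m\<bar>)\<^sup>2)"
    if h: "h * (1 + \<bar>Re (w - of_int m)\<bar>)\<^sup>2 \<le> C0 * exp (c * \<bar>Im (w - of_int m)\<bar>)"
      and h0: "h \<ge> 0" and w: "norm w \<le> \<rho>" for h w m
  proof -
    have Re: "\<bar>Re w\<bar> \<le> \<rho>" and Im: "\<bar>Im w\<bar> \<le> \<rho>"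
      using w abs_Re_le_cmod[of w] abs_Im_le_cmod[of w] by linarith+
    have "1 + \<bar>real_of_int m\<bar> \<le> 1 + \<rho> + \<bar>Re w - of_int m\<bar>" using Re by linarith
    also have "\<dots> \<le> (1 + \<rho>) * (1 + \<bar>Re w - of_int m\<bar>)"
      using True by (simp add: algebra_simps)
    finally have "h * (1 + \<bar>real_of_int m\<bar>)\<^sup>2 \<le> h * ((1 + \<rho>) * (1 + \<bar>Re w - of_int m\<bar>))\<^sup>2"
      by (intro mult_left_mono power_mono h0) auto
    also have "\<dots> = (1 + \<rho>)\<^sup>2 * (h * (1 + \<bar>Re w - of_int m\<bar>)\<^sup>2)"
      by (simp add: power_mult_distrib)
    also have "\<dots> \<le> (1 + \<rho>)\<^sup>2 * (C0 * exp (c * \<bar>Im w\<bar>))"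
      using h by (intro mult_left_mono) auto
    also have "\<dots> \<le> (1 + \<rho>)\<^sup>2 * (C0 * exp (c * \<rho>))"
      using C0(1) c_pos Im by (intro mult_left_mono) auto
    also have "\<dots> = C1" by (simp add: C1_def)
    finally show ?thesis by (simp add: pos_le_divide_eq add_pos_nonneg)
  qed
  show ?thesis
  proof (rule that[of "CARD('n) * C1 ^ CARD('n)"])
    fix z v :: "complex ^ 'n" and \<nu> :: "'n \<Rightarrow> int" assume z: "norm z \<le> \<rho>"
    have zj: "norm (z $ j) \<le> \<rho>" for j
      using z Finite_Cartesian_Product.norm_nth_le[of z j] by linarith
    define w where "w = (\<lambda>j. C1 * (1 / (1 + \<bar>real_of_int (\<nu> j)\<bar>)\<^sup>2))"
    have k: "norm (k (z $ j - of_int (\<nu> j))) \<le> w j" and k': "norm (k' (z $ j - of_int (\<nu> j))) \<le> w j" for j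
      unfolding w_def by (rule transfer[OF C0(2) _ zj] transfer[OF C0(3) _ zj]; simp)+
    have w0: "w j \<ge> 0" for j using C1 by (simp add: w_def)
    have "norm (tensor_kernel_deriv k k' z \<nu> v)
          \<le> (\<Sum>i\<in>UNIV. norm (k' (z $ i - of_int (\<nu> i))) * norm (v $ i)
                 * (\<Prod>j\<in>UNIV - {i}. norm (k (z $ j - of_int (\<nu> j)))))"
      unfolding tensor_kernel_deriv_def by (rule order_trans[OF norm_sum]) (simp add: norm_mult prod_norm)
    also have "\<dots> \<le> (\<Sum>i\<in>UNIV. w i * norm v * (\<Prod>j\<in>UNIV - {i}. w j))"
      by (intro sum_mono mult_mono k k' prod_mono conjI Finite_Cartesian_Product.norm_nth_le
            prod_nonneg mult_nonneg_nonneg w0) auto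
    also have "\<dots> = (\<Sum>i\<in>(UNIV::'n set). norm v * (\<Prod>j\<in>UNIV. w j))"
    proof (rule sum.cong[OF refl])
      fix i :: 'n
      have "(\<Prod>j\<in>UNIV. w j) = w i * (\<Prod>j\<in>UNIV - {i}. w j)"
        by (rule prod.remove) auto
      then show "w i * norm v * (\<Prod>j\<in>UNIV - {i}. w j) = norm v * (\<Prod>j\<in>UNIV. w j)"
        by (simp add: mult_ac)
    qed
    also have "\<dots> = CARD('n) * C1 ^ CARD('n) * lattice_weight 0 \<nu> * norm v"
      unfolding w_def prod.distrib lattice_weight_def by (simp add: abs_minus_commute)
    finally show "norm (tensor_kernel_deriv k k' z \<nu> v) \<le> CARD('n) * C1 ^ CARD('n) * lattice_weight 0 \<nu> * norm v" .
  qed (use C1 in auto)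
next
  \<comment> \<open>No \<open>z\<close> has norm below a negative \<open>\<rho>\<close>, so any
    positive constant will do.\<close>
  case False
  show ?thesis
  proof (rule that[of 1])
    fix z v :: "complex ^ 'n" and \<nu> :: "'n \<Rightarrow> int" assume "norm z \<le> \<rho>"
    with False norm_ge_zero[of z] have False by linarith
    then show "norm (tensor_kernel_deriv k k' z \<nu> v) \<le> 1 * lattice_weight 0 \<nu> * norm v" ..
  qed simp
qed

definition real_kernel :: "real ^ 'n \<Rightarrow> ('n::finite \<Rightarrow> int) \<Rightarrow> real" where
  "real_kernel x \<nu> = (\<Prod>j\<in>UNIV. Re (k (of_real (x $ j - of_int (\<nu> j)))))"

lemma tensor_kernel_cvec_0: "tensor_kernel k (cvec x 0) \<nu> = of_real (real_kernel x \<nu>)"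
proof -
  have "of_real (Re (k (of_real t))) = k (of_real t)" for t :: real
    using k_real[of t] by (simp add: of_real_Re)
  moreover have "cvec x 0 $ j - of_int (\<nu> j) = of_real (x $ j - of_int (\<nu> j))" for j
    by (simp add: cvec_def)
  ultimately show ?thesis
    by (simp only: tensor_kernel_def real_kernel_def of_real_prod)
qed

lemma real_kernel_nonneg: "real_kernel x \<nu> \<ge> 0"
  unfolding real_kernel_def by (intro prod_nonneg k_nonneg)

lemma real_kernel_has_sum: "(real_kernel x has_sum 1) UNIV"
proof -
  have sum: "((\<lambda>m::int. Re (k (of_real (t - of_int m)))) has_sum 1) UNIV" for t :: real
    using has_sum_Re[OF k_sum[of t]] by simp
  have "real_kernel x summable_on UNIV"
    unfolding real_kernel_def
    by (rule summable_on_prod_fun[OF k_nonneg has_sum_imp_summable[OF sum]])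
  moreover have "infsum (real_kernel x) UNIV = (\<Prod>j\<in>(UNIV :: 'a set). 1)"
    unfolding real_kernel_def
    by (subst infsum_prod_fun[OF k_nonneg has_sum_imp_summable[OF sum]]) (simp only: infsumI[OF sum])
  ultimately show ?thesis by (simp add: has_sum_iff)
qed

lemma real_kernel_decay:
  obtains C where "C > 0"
    "\<And>(x :: real ^ 'n) \<nu>. real_kernel x \<nu> * (1 + norm (x - lattice_vec \<nu>)) ^ N \<le> C * lattice_weight x \<nu>"
proof -
  obtain C where C: "C > 0"
    "\<And>(x :: real ^ 'n) y \<nu>. norm (tensor_kernel k (cvec x y) \<nu>) * (1 + norm (x - lattice_vec \<nu>)) ^ N
        \<le> C * exp (c * CARD('n) * norm y) * lattice_weight x \<nu>"
    by (rule tensor_kernel_decay[of N]) (rule that)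
  show ?thesis
  proof (rule that)
    show "real_kernel x \<nu> * (1 + norm (x - lattice_vec \<nu>)) ^ N \<le> C * lattice_weight x \<nu>" for x :: "real ^ 'n" and \<nu>
      using C(2)[of x 0 \<nu>] by (simp add: tensor_kernel_cvec_0 real_kernel_nonneg)
  qed fact
qed

text \<open>\<open>\<phi>\<close> is also evaluated at negative arguments, where it is only bounded by 1.\<close>

lemma tail_function:
  obtains \<phi> :: "real \<Rightarrow> real" where
    "antimono \<phi>" "\<And>t. 0 \<le> \<phi> t" "\<And>t. \<phi> t \<le> 1"
    "\<And>(x :: real ^ 'n) t. infsum (real_kernel x) {\<nu>. t \<le> norm (x - lattice_vec \<nu>)} \<le> \<phi> t"
    "\<And>N. \<exists>C. \<forall>t\<ge>0. \<phi> t * (1 + t) ^ N \<le> C"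
proof -
  define T where "T = (\<lambda>t (x :: real ^ 'n). infsum (real_kernel x) {\<nu>. t \<le> norm (x - lattice_vec \<nu>)})"
  have summ: "real_kernel x summable_on S" for S and x :: "real ^ 'n"
    using has_sum_imp_summable[OF real_kernel_has_sum] by (rule summable_on_subset) auto
  have T0: "T t x \<ge> 0" for t x
    unfolding T_def by (intro infsum_nonneg real_kernel_nonneg)
  have T1: "T t x \<le> 1" for t x
  proof -
    have "T t x \<le> infsum (real_kernel x) UNIV"
      unfolding T_def by (rule infsum_mono2) (auto intro: summ real_kernel_nonneg)
    then show ?thesis using infsumI[OF real_kernel_has_sum[of x]] by simp
  qed
  \<comment> \<open>The masses are at most 1, so their supremum over \<open>x\<close> is a genuine
    one; it serves as \<open>\<phi>\<close>.\<close>
  have bdd: "bdd_above (range (T t))" for t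
    using T1 by (intro bdd_aboveI[of _ 1]) auto
  have T_le: "T t x \<le> (SUP x. T t x)" for t x
    by (rule cSUP_upper[OF _ bdd]) simp
  show ?thesis
  proof (rule that[of "\<lambda>t. SUP x. T t x"])
    show "antimono (\<lambda>t. SUP x. T t x)"
    proof (rule antimonoI, rule cSUP_mono[OF _ bdd])
      fix s t :: real and x assume "s \<le> t"
      then have "T t x \<le> T s x"
        unfolding T_def by (intro infsum_mono2 summ) (auto intro: real_kernel_nonneg)
      then show "\<exists>y\<in>UNIV. T t x \<le> T s y" by blast
    qed auto
    show "0 \<le> (SUP x. T t x)" for t
      using T0[of t 0] T_le[of t 0] by linarith
    show "(SUP x. T t x) \<le> 1" for t
      by (rule cSUP_least) (auto intro: T1)
    show "infsum (real_kernel x) {\<nu>. t \<le> norm (x - lattice_vec \<nu>)} \<le> (SUP x. T t x)" for x :: "real ^ 'n" and t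
      using T_le[of t x] by (simp add: T_def)
    fix N
    obtain Q :: real where Q: "Q > 0"
      "\<And>x :: real ^ 'n. lattice_weight x summable_on UNIV"
      "\<And>x :: real ^ 'n. infsum (lattice_weight x) UNIV \<le> Q"
      by (rule lattice_weight_sum_bounded) (rule that)
    obtain C where C: "C > 0"
      "\<And>(x :: real ^ 'n) \<nu>. real_kernel x \<nu> * (1 + norm (x - lattice_vec \<nu>)) ^ N \<le> C * lattice_weight x \<nu>"
      by (rule real_kernel_decay[of N]) (rule that)
    show "\<exists>C. \<forall>t\<ge>0. (SUP x. T t x) * (1 + t) ^ N \<le> C"
    proof (intro exI allI impI)
      fix t :: real assume t: "t \<ge> 0"
      \<comment> \<open>On the tail set \<open>1 + t\<close> is at most
        \<open>1 + norm (x - lattice_vec \<nu>)\<close>; after absorbing that power the sum is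
        extended to all \<open>\<nu>\<close> and bounded by \<open>C * Q\<close> uniformly in
        \<open>x\<close>.\<close>
      have "T t x \<le> C * Q / (1 + t) ^ N" for x
      proof -
        have "T t x * (1 + t) ^ N = (\<Sum>\<^sub>\<infinity>\<nu>\<in>{\<nu>. t \<le> norm (x - lattice_vec \<nu>)}. real_kernel x \<nu> * (1 + t) ^ N)"
          unfolding T_def by (rule infsum_cmult_left'[symmetric])
        also have "\<dots> \<le> (\<Sum>\<^sub>\<infinity>\<nu>. C * lattice_weight x \<nu>)"
        proof (rule infsum_mono_neutral)
          fix \<nu> assume "\<nu> \<in> {\<nu>. t \<le> norm (x - lattice_vec \<nu>)} \<inter> UNIV"
          then have "real_kernel x \<nu> * (1 + t) ^ N \<le> real_kernel x \<nu> * (1 + norm (x - lattice_vec \<nu>)) ^ N"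
            using t by (intro mult_left_mono power_mono real_kernel_nonneg) auto
          also note C(2)
          finally show "real_kernel x \<nu> * (1 + t) ^ N \<le> C * lattice_weight x \<nu>" .
        qed (use C(1) in \<open>auto intro!: mult_nonneg_nonneg summable_on_cmult_left summable_on_cmult_right summ Q(2) lattice_weight_nonneg\<close>)
        also have "\<dots> = C * infsum (lattice_weight x) UNIV"
          by (rule infsum_cmult_right')
        also have "\<dots> \<le> C * Q"
          using C(1) Q(3) by (intro mult_left_mono) auto
        finally show ?thesis using t by (simp add: pos_le_divide_eq)
      qed
      then have "(SUP x. T t x) \<le> C * Q / (1 + t) ^ N"
        by (intro cSUP_least) auto
      then show "(SUP x. T t x) * (1 + t) ^ N \<le> C * Q"
        using t by (simp add: pos_le_divide_eq)
    qed
  qed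
qed

section \<open>Entire functions given by lattice series\<close>

definition lattice_series :: "(('n::finite \<Rightarrow> int) \<Rightarrow> real) \<Rightarrow> complex ^ 'n \<Rightarrow> complex" where
  "lattice_series a z = (\<Sum>\<^sub>\<infinity>\<nu>. of_real (a \<nu>) * tensor_kernel k z \<nu>)"

text \<open>With bounded coefficients each term is dominated by a multiple of
  \<open>lattice_weight x \<nu>\<close>, whose total mass is bounded independently of
  \<open>x\<close>; only the exponential in \<open>norm y\<close> remains.\<close>

lemma lattice_series_bound:
  fixes a :: "('n::finite \<Rightarrow> int) \<Rightarrow> real"
  assumes a: "\<And>\<nu>. \<bar>a \<nu>\<bar> \<le> M"
  shows lattice_series_abs_summable:
      "(\<lambda>\<nu>. norm (of_real (a \<nu>) * tensor_kernel k z \<nu>)) summable_on UNIV"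
    and lattice_series_growth:
      "\<exists>C. \<forall>x y. norm (lattice_series a (cvec x y)) \<le> C * exp (c * CARD('n) * norm y)"
proof -
  obtain Q :: real where Q: "Q > 0"
    "\<And>x :: real ^ 'n. lattice_weight x summable_on UNIV"
    "\<And>x :: real ^ 'n. infsum (lattice_weight x) UNIV \<le> Q"
    by (rule lattice_weight_sum_bounded) (rule that)
  obtain C where C: "C > 0"
    "\<And>(x :: real ^ 'n) y \<nu>. norm (tensor_kernel k (cvec x y) \<nu>) * (1 + norm (x - lattice_vec \<nu>)) ^ 0
       \<le> C * exp (c * CARD('n) * norm y) * lattice_weight x \<nu>"
    by (rule tensor_kernel_decay[of 0]) (rule that)
  note C' = C(2)[unfolded power_0 mult_1_right]
  have M: "M \<ge> 0" using a[of undefined] by linarith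
  have le: "norm (of_real (a \<nu>) * tensor_kernel k (cvec x y) \<nu>) \<le> M * (C * exp (c * CARD('n) * norm y)) * lattice_weight x \<nu>"
    for x y \<nu>
    unfolding norm_mult mult.assoc using mult_mono[OF a C' M] by (simp add: mult.assoc)
  have summ: "(\<lambda>\<nu>. M * (C * exp (c * CARD('n) * norm y)) * lattice_weight x \<nu>) summable_on UNIV"
    for x y :: "real ^ 'n"
    by (intro summable_on_cmult_right Q)
  have abs: "(\<lambda>\<nu>. norm (of_real (a \<nu>) * tensor_kernel k (cvec x y) \<nu>)) summable_on UNIV" for x y
    by (rule summable_on_comparison_test[OF summ le]) auto
  \<comment> \<open>Every complex vector splits into real and imaginary parts, so the bound for
    \<open>cvec x y\<close> covers all \<open>z\<close>.\<close>
  have "z = cvec (\<chi> j. Re (z $ j)) (\<chi> j. Im (z $ j))"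
    by (simp add: vec_eq_iff cvec_def complex_eq)
  with abs show "(\<lambda>\<nu>. norm (of_real (a \<nu>) * tensor_kernel k z \<nu>)) summable_on UNIV"
    by metis
  show "\<exists>C. \<forall>x y. norm (lattice_series a (cvec x y)) \<le> C * exp (c * CARD('n) * norm y)"
  proof (intro exI allI)
    fix x y :: "real ^ 'n"
    have "norm (lattice_series a (cvec x y)) \<le> (\<Sum>\<^sub>\<infinity>\<nu>. M * (C * exp (c * CARD('n) * norm y)) * lattice_weight x \<nu>)"
      unfolding lattice_series_def
      by (rule order_trans[OF norm_infsum_bound[OF abs] infsum_mono[OF abs summ le]])
    also have "\<dots> = M * (C * exp (c * CARD('n) * norm y)) * infsum (lattice_weight x) UNIV"
      by (rule infsum_cmult_right')
    also have "\<dots> \<le> M * (C * exp (c * CARD('n) * norm y)) * Q"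
      using M C(1) by (intro mult_left_mono Q(3)) auto
    finally show "norm (lattice_series a (cvec x y)) \<le> (M * C * Q) * exp (c * CARD('n) * norm y)"
      by (simp add: mult_ac)
  qed
qed

lemma lattice_series_cvec_0:
  assumes "\<And>\<nu>. \<bar>a \<nu>\<bar> \<le> M"
  shows "lattice_series a (cvec x 0) = of_real (\<Sum>\<^sub>\<infinity>\<nu>. a \<nu> * real_kernel x \<nu>)"
    and "(\<lambda>\<nu>. a \<nu> * real_kernel x \<nu>) summable_on UNIV"
proof -
  have "(\<lambda>\<nu>. norm (complex_of_real (a \<nu> * real_kernel x \<nu>))) summable_on UNIV"
    using lattice_series_abs_summable[OF assms, where z="cvec x 0"]
    by (simp only: tensor_kernel_cvec_0 of_real_mult)
  then have "(\<lambda>\<nu>. norm (a \<nu> * real_kernel x \<nu>)) summable_on UNIV"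
    by (simp only: norm_of_real real_norm_def)
  then show *: "(\<lambda>\<nu>. a \<nu> * real_kernel x \<nu>) summable_on UNIV"
    by (rule Infinite_Sum.abs_summable_summable)
  have "((\<lambda>\<nu>. complex_of_real (a \<nu> * real_kernel x \<nu>)) has_sum of_real (\<Sum>\<^sub>\<infinity>\<nu>. a \<nu> * real_kernel x \<nu>)) UNIV"
    by (rule has_sum_of_real[OF has_sum_infsum[OF *]])
  then show "lattice_series a (cvec x 0) = of_real (\<Sum>\<^sub>\<infinity>\<nu>. a \<nu> * real_kernel x \<nu>)"
    unfolding lattice_series_def tensor_kernel_cvec_0 by (simp add: infsumI)
qed

lemma tensor_kernel_deriv_scale:
  "tensor_kernel_deriv k k' z \<nu> (b *s v) = b * tensor_kernel_deriv k k' z \<nu> v"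
  by (simp add: tensor_kernel_deriv_def sum_distrib_left mult_ac)

text \<open>Termwise differentiation on a ball around 0 containing \<open>z0\<close>, with the
  majorant of \<open>tensor_kernel_deriv_bound\<close>. Complex linearity of the derivative passes
  from the terms to the sum.\<close>

lemma lattice_series_entire:
  fixes a :: "('n::finite \<Rightarrow> int) \<Rightarrow> real"
  assumes a: "\<And>\<nu>. \<bar>a \<nu>\<bar> \<le> M"
  shows "entire_cvec (lattice_series a)"
  unfolding entire_cvec_def
proof
  fix z0 :: "complex ^ 'n"
  have M: "M \<ge> 0" using a[of undefined] by linarith
  define S where "S = ball (0 :: complex ^ 'n) (norm z0 + 1)"
  obtain C where C: "C > 0"
    "\<And>(z :: complex ^ 'n) \<nu> v. norm z \<le> norm z0 + 1 \<Longrightarrow>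
       norm (tensor_kernel_deriv k k' z \<nu> v) \<le> C * lattice_weight 0 \<nu> * norm v"
    by (rule tensor_kernel_deriv_bound[of "norm z0 + 1"]) (rule that)
  \<comment> \<open>The lattice is countably infinite, so it can be enumerated by \<open>nat\<close>
    and the differentiation theorem for sequences of terms applies.\<close>
  have inf: "infinite (UNIV :: ('n::finite \<Rightarrow> int) set)"
    by (simp add: finite_UNIV_fun)
  define e :: "nat \<Rightarrow> 'n \<Rightarrow> int" where "e = from_nat_into UNIV"
  have e: "bij_betw e UNIV UNIV"
    unfolding e_def by (rule bij_betw_from_nat_into) (use inf in auto)
  define m where "m = (\<lambda>n. M * (C * lattice_weight (0 :: real ^ 'n) (e n)))"
  obtain Q :: real where "\<And>x :: real ^ 'n. lattice_weight x summable_on UNIV"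
    by (rule lattice_weight_sum_bounded) blast
  then have "(\<lambda>n. lattice_weight (0 :: real ^ 'n) (e n)) summable_on UNIV"
    by (simp add: summable_on_reindex_bij_betw[OF e])
  then have m: "summable m"
    unfolding m_def by (intro summable_mult summable_on_imp_summable)
  define D where "D = (\<lambda>n z v. of_real (a (e n)) * tensor_kernel_deriv k k' z (e n) v)"
  have D_bound: "norm (D n z v) \<le> m n * norm v" if "z \<in> S" for n z v
  proof -
    have "norm (D n z v) \<le> M * (C * lattice_weight 0 (e n) * norm v)"
      unfolding D_def norm_mult
      by (intro mult_mono) (use that a M C in \<open>auto simp: S_def\<close>)
    then show ?thesis by (simp add: m_def mult.assoc)
  qed
  have D_summ: "summable (\<lambda>n. D n z v)" if "z \<in> S" for z v
    by (rule summable_comparison_test'[OF summable_mult2[OF m], of 0]) (use D_bound[OF that] in auto)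
  define D' where "D' = (\<lambda>z v. \<Sum>n. D n z v)"
  have sums: "(\<lambda>n. of_real (a (e n)) * tensor_kernel k z (e n)) sums lattice_series a z" for z
  proof (rule has_sum_imp_sums)
    have "((\<lambda>\<nu>. of_real (a \<nu>) * tensor_kernel k z \<nu>) has_sum lattice_series a z) UNIV"
      unfolding lattice_series_def
      by (rule has_sum_infsum[OF Infinite_Sum.abs_summable_summable[OF lattice_series_abs_summable[OF a]]])
    then show "((\<lambda>n. of_real (a (e n)) * tensor_kernel k z (e n)) has_sum lattice_series a z) UNIV"
      using has_sum_reindex_bij_betw[OF e, of "\<lambda>\<nu>. of_real (a \<nu>) * tensor_kernel k z \<nu>"] by simp
  qed
  have "\<exists>g. \<forall>z\<in>S. (\<lambda>n. of_real (a (e n)) * tensor_kernel k z (e n)) sums g z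
                   \<and> (g has_derivative D' z) (at z within S)"
  proof (rule has_derivative_series)
    show "convex S" by (simp add: S_def)
    show "((\<lambda>z. of_real (a (e n)) * tensor_kernel k z (e n)) has_derivative D n z) (at z within S)" for n z
      unfolding D_def
      by (intro has_derivative_mult_right has_derivative_at_withinI[OF tensor_kernel_has_derivative])
    show "\<forall>\<^sub>F n in sequentially. \<forall>z\<in>S. \<forall>h. norm ((\<Sum>i<n. D i z h) - D' z h) \<le> \<epsilon> * norm h" if "\<epsilon> > 0" for \<epsilon>
    proof -
      \<comment> \<open>The derivative series converges uniformly in operator norm: its remainder
        after \<open>n\<close> terms is at most the remainder of the numerical series
        \<open>m\<close>.\<close>
      have "(\<lambda>n. \<Sum>i. m (i + n)) \<longlonglongrightarrow> 0"
        using suminf_exist_split2[OF m] by simp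
      then have "\<forall>\<^sub>F n in sequentially. (\<Sum>i. m (i + n)) < \<epsilon>"
        using that by (rule order_tendstoD)
      then show ?thesis
      proof eventually_elim
        case (elim n)
        show ?case
        proof (intro ballI allI)
          fix z h :: "complex ^ 'n" assume z: "z \<in> S"
          have mh: "summable (\<lambda>i. m (i + n) * norm h)"
            by (intro summable_mult2 summable_ignore_initial_segment m)
          have "(\<Sum>i<n. D i z h) - D' z h = - (\<Sum>i. D (i + n) z h)"
            unfolding D'_def using suminf_split_initial_segment[OF D_summ[OF z], of h n] by simp
          also have "norm \<dots> \<le> (\<Sum>i. m (i + n) * norm h)"
            unfolding norm_minus_cancel by (rule norm_suminf_le[OF D_bound[OF z] mh])
          also have "\<dots> = (\<Sum>i. m (i + n)) * norm h"
            by (rule suminf_mult2[symmetric]) (intro summable_ignore_initial_segment m)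
          also have "\<dots> \<le> \<epsilon> * norm h"
            using elim by (intro mult_right_mono) auto
          finally show "norm ((\<Sum>i<n. D i z h) - D' z h) \<le> \<epsilon> * norm h" .
        qed
      qed
    qed
    show "z0 \<in> S" by (simp add: S_def)
    show "(\<lambda>n. of_real (a (e n)) * tensor_kernel k z0 (e n)) sums lattice_series a z0"
      by (rule sums)
  qed
  then obtain g where g: "\<And>z. z \<in> S \<Longrightarrow> (\<lambda>n. of_real (a (e n)) * tensor_kernel k z (e n)) sums g z"
    "\<And>z. z \<in> S \<Longrightarrow> (g has_derivative D' z) (at z within S)" by blast
  have z0: "z0 \<in> S" by (simp add: S_def)
  \<comment> \<open>The ball is open, so the derivative within it is the full one, and
    \<open>g\<close> equals \<open>lattice_series a\<close> there by uniqueness of sums.\<close>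
  have "(g has_derivative D' z0) (at z0)"
    using g(2)[OF z0] at_within_open[OF z0] by (simp add: S_def)
  then have "(lattice_series a has_derivative D' z0) (at z0)"
    by (rule has_derivative_transform_within_open[OF _ _ z0 sums_unique2[OF g(1) sums]]) (simp_all add: S_def)
  moreover have "D' z0 (b *s v) = b * D' z0 v" for b v
  proof -
    have "D' z0 (b *s v) = (\<Sum>n. b * D n z0 v)"
      by (simp add: D'_def D_def tensor_kernel_deriv_scale mult_ac)
    then show ?thesis
      unfolding D'_def by (simp add: suminf_mult[OF D_summ[OF z0]])
  qed
  ultimately show "\<exists>D. (lattice_series a has_derivative D) (at z0) \<and> (\<forall>c v. D (c *s v) = c * D v)"
    by blast
qed

lemma scaled_lattice_series_exp_type:
  fixes a :: "('n::finite \<Rightarrow> int) \<Rightarrow> real"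
  assumes a: "\<And>\<nu>. \<bar>a \<nu>\<bar> \<le> M" and c: "c * CARD('n) \<le> 2 * pi" and R: "R > 0"
  shows "entire_exp_type R (\<lambda>z. lattice_series a (R *\<^sub>R z))"
  unfolding entire_exp_type_def
proof
  show "entire_cvec (\<lambda>z. lattice_series a (R *\<^sub>R z))"
    unfolding entire_cvec_def
  proof
    fix z :: "complex ^ 'n"
    obtain D where D: "(lattice_series a has_derivative D) (at (R *\<^sub>R z))" "\<And>c v. D (c *s v) = c * D v"
      using lattice_series_entire[of a M, OF a] unfolding entire_cvec_def by blast
    have "((\<lambda>z. R *\<^sub>R z) has_derivative (\<lambda>v. R *\<^sub>R v)) (at z)"
      by (intro has_derivative_scaleR_right has_derivative_ident)
    from has_derivative_compose[OF this D(1)]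
    have "((\<lambda>z. lattice_series a (R *\<^sub>R z)) has_derivative (\<lambda>v. D (R *\<^sub>R v))) (at z)" .
    moreover have "D (R *\<^sub>R (b *s v)) = b * D (R *\<^sub>R v)" for b v
    proof -
      have "R *\<^sub>R (b *s v) = b *s (R *\<^sub>R v)"
        by (simp add: vec_eq_iff)
      then show ?thesis by (simp add: D(2))
    qed
    ultimately show "\<exists>D. ((\<lambda>z. lattice_series a (R *\<^sub>R z)) has_derivative D) (at z) \<and> (\<forall>c v. D (c *s v) = c * D v)"
      by blast
  qed
  obtain C where C: "\<And>x y. norm (lattice_series a (cvec x y)) \<le> C * exp (c * CARD('n) * norm y)"
    using lattice_series_growth[of a M, OF a] by blast
  \<comment> \<open>Needed to enlarge the exponent afterwards; read off from the bound at the
    origin.\<close>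
  have "C \<ge> 0"
    using order_trans[OF norm_ge_zero C[of 0 0]] by simp
  show "\<exists>C. \<forall>x y. norm (lattice_series a (R *\<^sub>R cvec x y)) \<le> C * exp (2 * pi * R * norm y)"
  proof (intro exI allI)
    fix x y :: "real ^ 'n"
    have "R *\<^sub>R cvec x y = cvec (R *\<^sub>R x) (R *\<^sub>R y)"
      by (simp add: cvec_def vec_eq_iff complex_eq_iff)
    then have "norm (lattice_series a (R *\<^sub>R cvec x y)) \<le> C * exp (c * CARD('n) * (R * norm y))"
      using C[of "R *\<^sub>R x" "R *\<^sub>R y"] R by simp
    also have "\<dots> \<le> C * exp (2 * pi * (R * norm y))"
    proof -
      have "c * CARD('n) * (R * norm y) \<le> 2 * pi * (R * norm y)"
        using c R by (intro mult_right_mono) auto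
      then show ?thesis using \<open>C \<ge> 0\<close> by (intro mult_left_mono) (simp_all only: exp_le_cancel_iff)
    qed
    finally show "norm (lattice_series a (R *\<^sub>R cvec x y)) \<le> C * exp (2 * pi * R * norm y)"
      by (simp add: mult.assoc)
  qed
qed

end

section \<open>Approximation of indicator functions\<close>

text \<open>The lower bound holds because at least half of the mass lies at the \<open>\<nu>\<close> with
  \<open>r \<nu> < \<rho>\<close>, where \<open>\<phi> (u \<nu> - \<rho>) \<ge> \<phi> u0\<close>. For the upper bound the mass is split at \<open>r \<nu> = u0 / 2\<close>.\<close>

lemma smoothing_estimates:
  fixes \<kappa> r u \<omega> :: "'i \<Rightarrow> real" and \<phi> :: "real \<Rightarrow> real"
  assumes \<kappa>: "\<And>\<nu>. \<kappa> \<nu> \<ge> 0" "(\<kappa> has_sum 1) UNIV"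
    and tail: "\<And>t. infsum \<kappa> {\<nu>. t \<le> r \<nu>} \<le> \<phi> t"
    and \<phi>: "antimono \<phi>" "\<And>t. 0 \<le> \<phi> t" "\<And>t. \<phi> t \<le> 1"
    and \<rho>: "\<phi> \<rho> \<le> 1/2" "\<rho> \<ge> 0"
    and \<omega>: "\<And>\<nu>. \<bar>\<omega> \<nu> - \<omega>0\<bar> \<le> 1" "\<And>\<nu>. \<omega> \<nu> \<noteq> \<omega>0 \<Longrightarrow> u0 \<le> r \<nu>"
    and u: "\<And>\<nu>. \<bar>u \<nu> - u0\<bar> \<le> r \<nu>"
    and \<omega>_summable: "(\<lambda>\<nu>. \<omega> \<nu> * \<kappa> \<nu>) summable_on UNIV"
    and \<Phi>_summable: "(\<lambda>\<nu>. 2 * \<phi> (u \<nu> - \<rho>) * \<kappa> \<nu>) summable_on UNIV"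
  shows "\<bar>(\<Sum>\<^sub>\<infinity>\<nu>. \<omega> \<nu> * \<kappa> \<nu>) - \<omega>0\<bar> \<le> (\<Sum>\<^sub>\<infinity>\<nu>. 2 * \<phi> (u \<nu> - \<rho>) * \<kappa> \<nu>)"
    and "(\<Sum>\<^sub>\<infinity>\<nu>. 2 * \<phi> (u \<nu> - \<rho>) * \<kappa> \<nu>) \<le> 4 * \<phi> (u0 / 2 - \<rho>)"
proof -
  \<comment> \<open>The tail of \<open>\<kappa>\<close> extended by 0, so that all sums run over the
    same index set and can be compared term by term.\<close>
  define I where "I = (\<lambda>t \<nu>. if t \<le> r \<nu> then \<kappa> \<nu> else 0)"
  have \<kappa>_summable: "\<kappa> summable_on S" for S
    using has_sum_imp_summable[OF \<kappa>(2)] by (rule summable_on_subset) auto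
  have I_sum: "(I t has_sum infsum \<kappa> {\<nu>. t \<le> r \<nu>}) UNIV" for t
  proof -
    have "(\<kappa> has_sum infsum \<kappa> {\<nu>. t \<le> r \<nu>}) {\<nu>. t \<le> r \<nu>}"
      by (intro has_sum_infsum \<kappa>_summable)
    then show ?thesis
      by (subst (asm) has_sum_cong_neutral[where T=UNIV and g="I t"]) (auto simp: I_def)
  qed
  have \<Phi>_sum: "((\<lambda>\<nu>. 2 * \<phi> (u \<nu> - \<rho>) * \<kappa> \<nu>) has_sum (\<Sum>\<^sub>\<infinity>\<nu>. 2 * \<phi> (u \<nu> - \<rho>) * \<kappa> \<nu>)) UNIV"
    by (rule has_sum_infsum[OF \<Phi>_summable])
  have diff: "((\<lambda>\<nu>. (\<omega> \<nu> - \<omega>0) * \<kappa> \<nu>) has_sum ((\<Sum>\<^sub>\<infinity>\<nu>. \<omega> \<nu> * \<kappa> \<nu>) - \<omega>0)) UNIV"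
  proof -
    have "((\<lambda>\<nu>. \<omega> \<nu> * \<kappa> \<nu> + (- \<omega>0) * \<kappa> \<nu>) has_sum ((\<Sum>\<^sub>\<infinity>\<nu>. \<omega> \<nu> * \<kappa> \<nu>) + (- \<omega>0) * 1)) UNIV"
      by (intro has_sum_add has_sum_cmult_right \<kappa>(2) has_sum_infsum \<omega>_summable)
    then show ?thesis by (simp add: left_diff_distrib)
  qed
  \<comment> \<open>A term survives only where \<open>\<omega> \<nu>\<close> differs from
    \<open>\<omega>0\<close>, and this forces \<open>u0 \<le> r \<nu>\<close>.\<close>
  have pointwise: "\<bar>(\<omega> \<nu> - \<omega>0) * \<kappa> \<nu>\<bar> \<le> I u0 \<nu>" for \<nu>
    using \<omega>[of \<nu>] \<kappa>(1)[of \<nu>]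
    by (cases "\<omega> \<nu> = \<omega>0") (auto simp: I_def abs_mult mult_left_le_one_le)
  have "(\<Sum>\<^sub>\<infinity>\<nu>. \<omega> \<nu> * \<kappa> \<nu>) - \<omega>0 \<le> infsum \<kappa> {\<nu>. u0 \<le> r \<nu>}"
    by (rule has_sum_mono[OF diff I_sum]) (use pointwise in \<open>auto simp: abs_le_iff\<close>)
  moreover have "- ((\<Sum>\<^sub>\<infinity>\<nu>. \<omega> \<nu> * \<kappa> \<nu>) - \<omega>0) \<le> infsum \<kappa> {\<nu>. u0 \<le> r \<nu>}"
    by (rule has_sum_mono[OF has_sum_uminusI[OF diff] I_sum]) (use pointwise in \<open>auto simp: abs_le_iff\<close>)
  ultimately have "\<bar>(\<Sum>\<^sub>\<infinity>\<nu>. \<omega> \<nu> * \<kappa> \<nu>) - \<omega>0\<bar> \<le> \<phi> u0"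
    using tail[of u0] by linarith
  also have "\<phi> u0 \<le> (\<Sum>\<^sub>\<infinity>\<nu>. 2 * \<phi> (u \<nu> - \<rho>) * \<kappa> \<nu>)"
  proof -
    \<comment> \<open>The mass \<open>1 - s\<close> at distance below \<open>\<rho>\<close> is at
      least 1/2, which the factor 2 in the coefficients compensates.\<close>
    define s where "s = infsum \<kappa> {\<nu>. \<rho> \<le> r \<nu>}"
    have "((\<lambda>\<nu>. 2 * \<phi> u0 * (\<kappa> \<nu> + - I \<rho> \<nu>)) has_sum (2 * \<phi> u0 * (1 + - s))) UNIV"
      unfolding s_def by (intro has_sum_cmult_right has_sum_add has_sum_uminusI \<kappa>(2) I_sum)
    then have "2 * \<phi> u0 * (1 + - s) \<le> (\<Sum>\<^sub>\<infinity>\<nu>. 2 * \<phi> (u \<nu> - \<rho>) * \<kappa> \<nu>)"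
    proof (rule has_sum_mono[OF _ \<Phi>_sum])
      fix \<nu>
      have "\<phi> u0 \<le> \<phi> (u \<nu> - \<rho>)" if "r \<nu> < \<rho>"
        using u[of \<nu>] that by (intro antimonoD[OF \<phi>(1)]) linarith
      then show "2 * \<phi> u0 * (\<kappa> \<nu> + - I \<rho> \<nu>) \<le> 2 * \<phi> (u \<nu> - \<rho>) * \<kappa> \<nu>"
        using \<kappa>(1)[of \<nu>] \<phi>(2) by (auto simp: I_def intro!: mult_right_mono)
    qed
    moreover have "\<phi> u0 * 1 \<le> \<phi> u0 * (2 * (1 + - s))"
      using tail[of \<rho>] \<rho>(1) \<phi>(2) by (intro mult_left_mono) (auto simp: s_def)
    ultimately show ?thesis by (simp add: algebra_simps)
  qed
  finally show "\<bar>(\<Sum>\<^sub>\<infinity>\<nu>. \<omega> \<nu> * \<kappa> \<nu>) - \<omega>0\<bar> \<le> (\<Sum>\<^sub>\<infinity>\<nu>. 2 * \<phi> (u \<nu> - \<rho>) * \<kappa> \<nu>)" .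
  have "((\<lambda>\<nu>. 2 * \<phi> (u0 / 2 - \<rho>) * \<kappa> \<nu> + 2 * I (u0 / 2) \<nu>) has_sum
         (2 * \<phi> (u0 / 2 - \<rho>) * 1 + 2 * infsum \<kappa> {\<nu>. u0 / 2 \<le> r \<nu>})) UNIV"
    by (intro has_sum_add has_sum_cmult_right \<kappa>(2) I_sum)
  then have "(\<Sum>\<^sub>\<infinity>\<nu>. 2 * \<phi> (u \<nu> - \<rho>) * \<kappa> \<nu>)
             \<le> 2 * \<phi> (u0 / 2 - \<rho>) * 1 + 2 * infsum \<kappa> {\<nu>. u0 / 2 \<le> r \<nu>}"
  proof (rule has_sum_mono[OF \<Phi>_sum])
    fix \<nu>
    show "2 * \<phi> (u \<nu> - \<rho>) * \<kappa> \<nu> \<le> 2 * \<phi> (u0 / 2 - \<rho>) * \<kappa> \<nu> + 2 * I (u0 / 2) \<nu>"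
    proof (cases "u0 / 2 \<le> r \<nu>")
      case True
      have "\<phi> (u \<nu> - \<rho>) * \<kappa> \<nu> \<le> 1 * \<kappa> \<nu>" "0 \<le> \<phi> (u0 / 2 - \<rho>) * \<kappa> \<nu>"
        by (intro mult_right_mono mult_nonneg_nonneg \<phi> \<kappa>)+
      with True show ?thesis by (simp add: I_def)
    next
      case False
      then have "u0 / 2 - \<rho> \<le> u \<nu> - \<rho>" using u[of \<nu>] by (simp add: abs_le_iff)
      then have "\<phi> (u \<nu> - \<rho>) * \<kappa> \<nu> \<le> \<phi> (u0 / 2 - \<rho>) * \<kappa> \<nu>"
        by (intro mult_right_mono \<kappa>(1) antimonoD[OF \<phi>(1)])
      with False show ?thesis by (simp add: I_def)
    qed
  qed
  \<comment> \<open>Near and far part are now both at most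
    \<open>2 * \<phi> (u0 / 2 - \<rho>)\<close>, which gives the constant 4.\<close>
  moreover have "\<phi> (u0 / 2) \<le> \<phi> (u0 / 2 - \<rho>)"
    using \<rho>(2) by (intro antimonoD[OF \<phi>(1)]) simp
  ultimately show "(\<Sum>\<^sub>\<infinity>\<nu>. 2 * \<phi> (u \<nu> - \<rho>) * \<kappa> \<nu>) \<le> 4 * \<phi> (u0 / 2 - \<rho>)"
    using tail[of "u0 / 2"] by linarith
qed

text \<open>A real exponent is rounded up to a natural one, which is harmless because the base
  \<open>1 + t\<close> is at least 1.\<close>

lemma fast_decayI:
  assumes "\<And>N::nat. \<exists>C. \<forall>t\<ge>0. \<psi> t * (1 + t) ^ N \<le> C"
  shows "fast_decay \<psi>"
  unfolding fast_decay_def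
proof
  fix \<alpha> :: real
  define N where "N = nat \<lceil>\<alpha>\<rceil>"
  have N: "\<alpha> \<le> real N" by (simp add: N_def real_nat_ceiling_ge)
  obtain C where C: "\<And>t. t \<ge> 0 \<Longrightarrow> \<psi> t * (1 + t) ^ N \<le> C"
    using assms by blast
  show "\<exists>c. \<forall>t\<ge>0. \<psi> t \<le> c * (1 + t) powr (- \<alpha>)"
  proof (intro exI allI impI)
    fix t :: real assume t: "t \<ge> 0"
    have pow: "(1 + t) ^ N > 0" using t by simp
    have "\<psi> t * (1 + t) ^ N \<le> \<bar>C\<bar>" using C[OF t] by linarith
    then have "\<psi> t \<le> \<bar>C\<bar> * (1 / (1 + t) ^ N)"
      using pow by (simp add: pos_le_divide_eq)
    also have "1 / (1 + t) ^ N = (1 + t) powr (- real N)"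
      using t by (simp add: powr_minus_divide powr_realpow)
    also have "\<bar>C\<bar> * (1 + t) powr (- real N) \<le> \<bar>C\<bar> * (1 + t) powr (- \<alpha>)"
      using t N by (intro mult_left_mono powr_mono) auto
    finally show "\<psi> t \<le> \<bar>C\<bar> * (1 + t) powr (- \<alpha>)" .
  qed
qed

text \<open>The summand \<open>exp (- t)\<close> keeps the function strictly positive even where
  \<open>\<phi>\<close> vanishes.\<close>

lemma fast_decay_shifted:
  fixes \<phi> :: "real \<Rightarrow> real"
  assumes \<phi>: "\<And>N. \<exists>C. \<forall>t\<ge>0. \<phi> t * (1 + t) ^ N \<le> C" "\<And>t. 0 \<le> \<phi> t" "\<And>t. \<phi> t \<le> 1" and \<rho>: "\<rho> \<ge> 0"
  shows "fast_decay (\<lambda>t. 8 * \<phi> (t / 2 - \<rho>) + exp (- t))"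
proof (rule fast_decayI)
  fix N :: nat
  obtain C where C: "\<And>t. t \<ge> 0 \<Longrightarrow> \<phi> t * (1 + t) ^ N \<le> C"
    using \<phi>(1) by blast
  have C0: "C \<ge> 0" using C[of 0] \<phi>(2)[of 0] by simp
  \<comment> \<open>Serves both cases below: \<open>1 + t \<le> L * (1 + (t / 2 - \<rho>))\<close>
    when \<open>t \<ge> 2 * \<rho>\<close>, and \<open>1 + t \<le> L\<close> when
    \<open>t < 2 * \<rho>\<close>.\<close>
  define L where "L = 2 + 2 * \<rho>"
  define M where "M = real (Suc N)"
  have L: "L > 0" using \<rho> by (simp add: L_def)
  have shift: "\<phi> (t / 2 - \<rho>) * (1 + t) ^ N \<le> L ^ N * (C + 1)" if t: "t \<ge> 0" for t
  proof (cases "t / 2 - \<rho> \<ge> 0")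
    case True
    have "0 \<le> \<rho> * (t / 2 - \<rho>)" using True \<rho> by simp
    then have "1 + t \<le> L * (1 + (t / 2 - \<rho>))"
      using \<rho> True by (simp add: L_def algebra_simps)
    then have "\<phi> (t / 2 - \<rho>) * (1 + t) ^ N \<le> \<phi> (t / 2 - \<rho>) * (L * (1 + (t / 2 - \<rho>))) ^ N"
      using t \<phi>(2) by (intro mult_left_mono power_mono) auto
    also have "\<dots> = L ^ N * (\<phi> (t / 2 - \<rho>) * (1 + (t / 2 - \<rho>)) ^ N)"
      unfolding power_mult_distrib by simp
    also have "\<dots> \<le> L ^ N * (C + 1)"
      using L C[OF True] by (intro mult_left_mono) auto
    finally show ?thesis .
  next
    case False
    then have "\<phi> (t / 2 - \<rho>) * (1 + t) ^ N \<le> 1 * L ^ N"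
      using t \<phi> by (intro mult_mono power_mono) (auto simp: L_def)
    also have "\<dots> \<le> L ^ N * (C + 1)" using L C0 by simp
    finally show ?thesis .
  qed
  \<comment> \<open>Take the power \<open>Suc N\<close> of
    \<open>1 + t \<le> M * exp (t / M)\<close>; using \<open>Suc N\<close> in place of
    \<open>N\<close> keeps \<open>M\<close> nonzero.\<close>
  have exp: "exp (- t) * (1 + t) ^ N \<le> M ^ Suc N" if t: "t \<ge> 0" for t
  proof -
    have M: "M \<ge> 1" by (simp add: M_def)
    have "(1 + t) ^ N \<le> (1 + t) ^ Suc N" using t by (intro power_increasing) auto
    also have "\<dots> \<le> (M * exp (t / M)) ^ Suc N"
    proof (rule power_mono)
      have "1 + t \<le> M * (1 + t / M)" using M by (simp add: distrib_left)
      also have "\<dots> \<le> M * exp (t / M)" using M by (intro mult_left_mono exp_ge_add_one_self) auto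
      finally show "1 + t \<le> M * exp (t / M)" .
    qed (use t in simp)
    also have "\<dots> = M ^ Suc N * exp t"
    proof -
      have "exp (t / M) ^ Suc N = exp t"
        using M by (simp only: M_def flip: exp_of_nat_mult) simp
      then show ?thesis by (simp only: power_mult_distrib)
    qed
    finally show ?thesis by (simp add: exp_minus field_simps)
  qed
  show "\<exists>C. \<forall>t\<ge>0. (8 * \<phi> (t / 2 - \<rho>) + exp (- t)) * (1 + t) ^ N \<le> C"
  proof (intro exI allI impI)
    fix t :: real assume t: "t \<ge> 0"
    show "(8 * \<phi> (t / 2 - \<rho>) + exp (- t)) * (1 + t) ^ N \<le> 8 * (L ^ N * (C + 1)) + M ^ Suc N"
      using shift[OF t] exp[OF t] unfolding distrib_right by linarith
  qed
qed

lemma entire_exp_type_const: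
  assumes "R > 0"
  shows "entire_exp_type R (\<lambda>z :: complex ^ 'n. b)"
proof -
  have "norm b \<le> norm b * exp (2 * pi * R * norm y)" for y :: "real ^ 'n"
    using assms mult_left_mono[of 1 "exp (2 * pi * R * norm y)" "norm b"] by simp
  then show ?thesis
    by (auto simp: entire_exp_type_def entire_cvec_def intro!: exI[of _ "\<lambda>_. 0"])
qed

text \<open>The segment between a point of \<open>S\<close> and a point outside meets the frontier.
  Thus a lattice sample that misjudges the indicator at \<open>x\<close> lies at least as far from
  \<open>x\<close> as the frontier does.\<close>

lemma infdist_frontier_le_dist:
  fixes x y :: "'a :: euclidean_space"
  assumes "(x \<in> S) \<noteq> (y \<in> S)"
  shows "infdist x (frontier S) \<le> dist x y"
proof -
  have "closed_segment x y \<inter> frontier S \<noteq> {}"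
    using assms by (intro connected_Int_frontier) auto
  then obtain q where q: "q \<in> closed_segment x y" "q \<in> frontier S" by blast
  have "infdist x (frontier S) \<le> dist x q" by (rule infdist_le[OF q(2)])
  also have "\<dots> \<le> dist x y" using q(1) by (metis dist_in_closed_segment dist_commute)
  finally show ?thesis .
qed

section \<open>The minorant and the majorant\<close>

context partition_kernel
begin

lemma indicator_approximation:
  fixes \<Omega> :: "(real ^ 'n) set" and \<phi> :: "real \<Rightarrow> real"
  assumes \<phi>: "antimono \<phi>" "\<And>t. 0 \<le> \<phi> t" "\<And>t. \<phi> t \<le> 1"
    and tail: "\<And>(x :: real ^ 'n) t. infsum (real_kernel x) {\<nu>. t \<le> norm (x - lattice_vec \<nu>)} \<le> \<phi> t"
    and \<rho>: "\<phi> \<rho> \<le> 1/2" "\<rho> \<ge> 0"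
    and c: "c * CARD('n) \<le> 2 * pi" and R: "R > 0"
  shows "\<exists>A B :: complex ^ 'n \<Rightarrow> complex.
          entire_exp_type R A \<and> entire_exp_type R B \<and>
          (\<forall>x :: real ^ 'n.
             A (cvec x 0) \<in> \<real> \<and> B (cvec x 0) \<in> \<real> \<and>
             Re (A (cvec x 0)) \<le> indicator \<Omega> x \<and>
             indicator \<Omega> x \<le> Re (B (cvec x 0)) \<and>
             norm (B (cvec x 0) - A (cvec x 0)) \<le> 8 * \<phi> (R * infdist x (frontier \<Omega>) / 2 - \<rho>))"
proof -
  define p :: "('n \<Rightarrow> int) \<Rightarrow> real ^ 'n" where "p = (\<lambda>\<nu>. (1 / R) *\<^sub>R lattice_vec \<nu>)"
  define \<omega> :: "('n \<Rightarrow> int) \<Rightarrow> real" where "\<omega> = (\<lambda>\<nu>. indicator \<Omega> (p \<nu>))"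
  define u where "u = (\<lambda>x. R * infdist x (frontier \<Omega>))"
  define \<Phi> where "\<Phi> = (\<lambda>\<nu>. 2 * \<phi> (u (p \<nu>) - \<rho>))"
  have \<omega>_range: "0 \<le> \<omega> \<nu>" "\<omega> \<nu> \<le> 1" for \<nu> by (auto simp: \<omega>_def indicator_def)
  have \<Phi>_range: "0 \<le> \<Phi> \<nu>" "\<Phi> \<nu> \<le> 2" for \<nu> using \<phi>(2,3) by (auto simp: \<Phi>_def)
  \<comment> \<open>Every lemma on \<open>lattice_series\<close> asks for bounded
    coefficients.\<close>
  have bounds: "\<bar>\<omega> \<nu>\<bar> \<le> 1" "\<bar>\<Phi> \<nu>\<bar> \<le> 2" "\<bar>\<omega> \<nu> - \<Phi> \<nu>\<bar> \<le> 2" "\<bar>\<omega> \<nu> + \<Phi> \<nu>\<bar> \<le> 3" for \<nu>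
    using \<omega>_range[of \<nu>] \<Phi>_range[of \<nu>] by linarith+
  define A where "A = (\<lambda>z. lattice_series (\<lambda>\<nu>. \<omega> \<nu> - \<Phi> \<nu>) (R *\<^sub>R z))"
  define B where "B = (\<lambda>z. lattice_series (\<lambda>\<nu>. \<omega> \<nu> + \<Phi> \<nu>) (R *\<^sub>R z))"
  have main: "A (cvec x 0) \<in> \<real> \<and> B (cvec x 0) \<in> \<real> \<and>
             Re (A (cvec x 0)) \<le> indicator \<Omega> x \<and> indicator \<Omega> x \<le> Re (B (cvec x 0)) \<and>
             norm (B (cvec x 0) - A (cvec x 0)) \<le> 8 * \<phi> (u x / 2 - \<rho>)" for x
  proof -
    define \<kappa> where "\<kappa> = real_kernel (R *\<^sub>R x)"
    define r where "r = (\<lambda>\<nu>. norm (R *\<^sub>R x - lattice_vec \<nu>))"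
    have r: "r \<nu> = R * dist x (p \<nu>)" for \<nu>
    proof -
      have "R *\<^sub>R x - lattice_vec \<nu> = R *\<^sub>R (x - p \<nu>)"
        using R by (simp add: p_def algebra_simps)
      then show ?thesis using R by (simp add: r_def dist_norm)
    qed
    have cvec: "R *\<^sub>R cvec x 0 = cvec (R *\<^sub>R x) 0"
      by (simp add: cvec_def vec_eq_iff complex_eq_iff)
    define X where "X = (\<Sum>\<^sub>\<infinity>\<nu>. \<omega> \<nu> * \<kappa> \<nu>)"
    define Y where "Y = (\<Sum>\<^sub>\<infinity>\<nu>. \<Phi> \<nu> * \<kappa> \<nu>)"
    have summ: "(\<lambda>\<nu>. \<omega> \<nu> * \<kappa> \<nu>) summable_on UNIV" "(\<lambda>\<nu>. \<Phi> \<nu> * \<kappa> \<nu>) summable_on UNIV"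
      unfolding \<kappa>_def by (rule lattice_series_cvec_0(2), rule bounds)+
    have h1: "\<kappa> \<nu> \<ge> 0" for \<nu> by (simp add: \<kappa>_def real_kernel_nonneg)
    have h2: "(\<kappa> has_sum 1) UNIV" by (simp add: \<kappa>_def real_kernel_has_sum)
    have h3: "infsum \<kappa> {\<nu>. t \<le> r \<nu>} \<le> \<phi> t" for t by (simp add: \<kappa>_def r_def tail)
    have h4: "\<bar>\<omega> \<nu> - indicator \<Omega> x\<bar> \<le> 1" for \<nu> by (simp add: \<omega>_def indicator_def)
    have h5: "u x \<le> r \<nu>" if "\<omega> \<nu> \<noteq> indicator \<Omega> x" for \<nu>
    proof -
      have "(x \<in> \<Omega>) \<noteq> (p \<nu> \<in> \<Omega>)" using that by (auto simp: \<omega>_def indicator_def split: if_splits)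
      then show ?thesis unfolding u_def r using R infdist_frontier_le_dist by (intro mult_left_mono) auto
    qed
    \<comment> \<open>The distance to a set is 1-Lipschitz, and both \<open>u\<close> and
      \<open>r\<close> carry the factor \<open>R\<close>.\<close>
    have h6: "\<bar>u (p \<nu>) - u x\<bar> \<le> r \<nu>" for \<nu>
      unfolding u_def r right_diff_distrib[symmetric] abs_mult
      using R infdist_triangle_abs[of "p \<nu>" "frontier \<Omega>" x] by (simp add: dist_commute)
    have "\<bar>X - indicator \<Omega> x\<bar> \<le> Y" "Y \<le> 4 * \<phi> (u x / 2 - \<rho>)"
      using smoothing_estimates[OF h1 h2 h3 \<phi> \<rho> h4 h5 h6 summ[unfolded \<Phi>_def]]
      by (simp_all add: X_def Y_def \<Phi>_def)
    moreover have "((\<lambda>\<nu>. (\<omega> \<nu> - \<Phi> \<nu>) * \<kappa> \<nu>) has_sum (X - Y)) UNIV"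
      using has_sum_add[OF has_sum_infsum[OF summ(1)] has_sum_uminusI[OF has_sum_infsum[OF summ(2)]]]
      by (simp add: left_diff_distrib X_def Y_def)
    then have "A (cvec x 0) = of_real (X - Y)"
      unfolding A_def cvec \<kappa>_def lattice_series_cvec_0(1)[OF bounds(3)] by (simp only: infsumI)
    moreover have "((\<lambda>\<nu>. (\<omega> \<nu> + \<Phi> \<nu>) * \<kappa> \<nu>) has_sum (X + Y)) UNIV"
      unfolding distrib_right X_def Y_def by (intro has_sum_add has_sum_infsum summ)
    then have "B (cvec x 0) = of_real (X + Y)"
      unfolding B_def cvec \<kappa>_def lattice_series_cvec_0(1)[OF bounds(4)] by (simp only: infsumI)
    \<comment> \<open>The gap is twice the error series, so the bound 4 from
      \<open>smoothing_estimates\<close> becomes 8.\<close>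
    moreover have "norm (complex_of_real (X + Y) - of_real (X - Y)) = 2 * \<bar>Y\<bar>"
      unfolding of_real_diff[symmetric] norm_of_real by simp
    ultimately show ?thesis
      by (simp only: Reals_of_real Re_complex_of_real) (simp add: abs_le_iff)
  qed
  have "entire_exp_type R A" "entire_exp_type R B"
    unfolding A_def B_def by (rule scaled_lattice_series_exp_type[OF _ c R], rule bounds)+
  with main show ?thesis unfolding u_def by blast
qed

end

theorem theorem1:
  "\<exists>\<psi> :: real \<Rightarrow> real.
     (\<forall>t\<ge>0. 0 < \<psi> t) \<and> fast_decay \<psi> \<and>
     (\<forall>(\<Omega> :: (real ^ 'n) set) (R :: real). \<Omega> \<in> sets lebesgue \<longrightarrow> R > 0 \<longrightarrow>
       (\<exists>A B :: complex ^ 'n \<Rightarrow> complex.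
          entire_exp_type R A \<and> entire_exp_type R B \<and>
          (\<forall>x :: real ^ 'n.
             A (cvec x 0) \<in> \<real> \<and> B (cvec x 0) \<in> \<real> \<and>
             Re (A (cvec x 0)) \<le> indicator \<Omega> x \<and>
             indicator \<Omega> x \<le> Re (B (cvec x 0)) \<and>
             norm (B (cvec x 0) - A (cvec x 0)) \<le> decay_dist \<psi> R x (frontier \<Omega>))))"
proof -
  \<comment> \<open>One n-th of the admissible type \<open>2 * pi\<close> for each of the n
    variables.\<close>
  define c where "c = 2 * pi / CARD('n)"
  have c: "c > 0" "c * CARD('n) \<le> 2 * pi" by (simp_all add: c_def)
  obtain k k' where "partition_kernel k k' c"
    by (rule partition_of_unity_kernel[OF c(1)], rule that, rule partition_kernel.intro[OF c(1)])
  then interpret partition_kernel k k' c .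
  obtain \<phi> :: "real \<Rightarrow> real" where \<phi>: "antimono \<phi>" "\<And>t. 0 \<le> \<phi> t" "\<And>t. \<phi> t \<le> 1"
    "\<And>(x :: real ^ 'n) t. infsum (real_kernel x) {\<nu>. t \<le> norm (x - lattice_vec \<nu>)} \<le> \<phi> t"
    "\<And>N. \<exists>C. \<forall>t\<ge>0. \<phi> t * (1 + t) ^ N \<le> C"
    by (rule tail_function) (rule that)
  obtain C where C: "\<And>t. t \<ge> 0 \<Longrightarrow> \<phi> t * (1 + t) ^ 1 \<le> C"
    using \<phi>(5) by blast
  \<comment> \<open>With this choice \<open>C \<le> \<rho> / 2 \<le> (1 + \<rho>) / 2\<close>, so
    first-power decay already gives \<open>\<phi> \<rho> \<le> 1/2\<close>.\<close>
  define \<rho> where "\<rho> = 2 * \<bar>C\<bar>"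
  have \<rho>: "\<rho> \<ge> 0" "\<phi> \<rho> \<le> 1/2"
  proof -
    show "\<rho> \<ge> 0" by (simp add: \<rho>_def)
    then have "\<phi> \<rho> * (1 + \<rho>) \<le> 1/2 * (1 + \<rho>)"
      using C[of \<rho>] by (simp add: \<rho>_def)
    with \<open>\<rho> \<ge> 0\<close> show "\<phi> \<rho> \<le> 1/2" by (simp add: mult_le_cancel_right)
  qed
  define \<psi> where "\<psi> = (\<lambda>t. 8 * \<phi> (t / 2 - \<rho>) + exp (- t))"
  show ?thesis
  proof (intro exI[of _ \<psi>] conjI allI impI)
    show "0 < \<psi> t" for t
      using \<phi>(2) by (simp add: \<psi>_def add_nonneg_pos)
    show "fast_decay \<psi>"
      unfolding \<psi>_def by (rule fast_decay_shifted[OF \<phi>(5,2,3) \<rho>(1)])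
    fix \<Omega> :: "(real ^ 'n) set" and R :: real assume R: "R > 0"
    show "\<exists>A B :: complex ^ 'n \<Rightarrow> complex.
          entire_exp_type R A \<and> entire_exp_type R B \<and>
          (\<forall>x :: real ^ 'n.
             A (cvec x 0) \<in> \<real> \<and> B (cvec x 0) \<in> \<real> \<and>
             Re (A (cvec x 0)) \<le> indicator \<Omega> x \<and>
             indicator \<Omega> x \<le> Re (B (cvec x 0)) \<and>
             norm (B (cvec x 0) - A (cvec x 0)) \<le> decay_dist \<psi> R x (frontier \<Omega>))"
    proof (cases "frontier \<Omega> = {}")
      \<comment> \<open>With empty frontier \<open>decay_dist\<close> is 0, so \<open>A\<close> and
        \<open>B\<close> must agree on the real points; the indicator is constant here and that
        constant serves as both.\<close>
      case True
      then have "\<Omega> = {} \<or> \<Omega> = UNIV" by (simp add: frontier_eq_empty)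
      then obtain b :: real where "\<And>x. indicator \<Omega> x = b"
        by fastforce
      then show ?thesis
        using True R by (intro exI[of _ "\<lambda>_. of_real b"]) (simp add: entire_exp_type_const decay_dist_def)
    next
      case False
      have "8 * \<phi> (R * infdist x (frontier \<Omega>) / 2 - \<rho>) \<le> decay_dist \<psi> R x (frontier \<Omega>)" for x
        using False by (simp add: decay_dist_def \<psi>_def)
      with indicator_approximation[OF \<phi>(1-4) \<rho>(2,1) c(2) R, of \<Omega>] show ?thesis
        by (meson order_trans)
    qed
  qed
qed

end
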